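(* The map $\Delta^\infty:\mathcal{M}_r(\mathbb{C})\to\mathcal{M}_r(\mathbb{C})$, $\Delta^\infty(T)=\lim_{n\to\infty}\Delta^n(T)$, is continuous on $\mathcal{G}l_r(\mathbb{C})$.
   Context: $\mathcal{M}_r(\mathbb{C})$ denotes the complex $r\times r$ matrices and $\mathcal{G}l_r(\mathbb{C})$ the invertible ones. For $T$ with polar decomposition $T=U|T|$, the Aluthge transform is $\Delta(T)=|T|^{1/2}U|T|^{1/2}$; $\Delta^0(T)=T$, $\Delta^n(T)=\Delta(\Delta^{n-1}(T))$. It is known (and used as a fact here) that for every $T\in\mathcal{M}_r(\mathbb{C})$ the limit $\lim_{n\to\infty}\Delta^n(T)$ exists, so $\Delta^\infty$ is well defined on $\mathcal{M}_r(\mathbb{C})$. *)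

theory Defs
  imports "HOL-Analysis.Analysis"
begin

definition adjoint_mat :: "complex^'n^'m \<Rightarrow> complex^'m^'n" where
  "adjoint_mat A = (\<chi> i j. cnj (A $ j $ i))"

definition unitary_mat :: "complex^'n^'n \<Rightarrow> bool" where
  "unitary_mat U \<longleftrightarrow> adjoint_mat U ** U = mat 1 \<and> U ** adjoint_mat U = mat 1"

definition hermitian_mat :: "complex^'n^'n \<Rightarrow> bool" where
  "hermitian_mat A \<longleftrightarrow> adjoint_mat A = A"

definition psd_mat :: "complex^'n^'n \<Rightarrow> bool" where
  "psd_mat A \<longleftrightarrow> hermitian_mat A \<and>
     (\<forall>x::complex^'n. 0 \<le> Re (\<Sum>i\<in>UNIV. cnj (x $ i) * (A *v x) $ i))"

definition psd_sqrt :: "complex^'n^'n \<Rightarrow> complex^'n^'n" where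
  "psd_sqrt A = (THE B. psd_mat B \<and> B ** B = A)"

definition mat_abs :: "complex^'n^'n \<Rightarrow> complex^'n^'n" where
  "mat_abs T = psd_sqrt (adjoint_mat T ** T)"

text \<open>Aluthge transform \<open>|T|^(1/2) U |T|^(1/2)\<close> for a polar decomposition \<open>T = U |T|\<close>
  with U unitary (the result does not depend on the choice of U).\<close>
definition aluthge :: "complex^'n^'n \<Rightarrow> complex^'n^'n" where
  "aluthge T = (let U = (SOME U. unitary_mat U \<and> T = U ** mat_abs T)
                in psd_sqrt (mat_abs T) ** U ** psd_sqrt (mat_abs T))"

definition aluthge_inf :: "complex^'n^'n \<Rightarrow> complex^'n^'n" where
  "aluthge_inf T = lim (\<lambda>n. (aluthge ^^ n) T)"

end

theory Submission
  imports Defs "HOL-Computational_Algebra.Fundamental_Theorem_Algebra"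
begin

text \<open>
  Write \<open>T = U S\<^sup>2\<close> with \<open>U\<close> unitary and \<open>S = |T|\<^sup>1\<^sup>/\<^sup>2\<close>; then \<open>\<Delta>(T) = S U S = S T S\<^sup>-\<^sup>1\<close>. The Frobenius
  norm strictly decreases under \<open>\<Delta>\<close> unless \<open>T\<close> is normal, and the spectrum is preserved, so by
  compactness the orbits of all matrices near a given \<open>T0\<close> become uniformly close to normal matrices
  with the spectrum of \<open>T0\<close>. Inside a cluster of nearby eigenvalues the iteration may be slow, but
  the spectral idempotents \<open>E\<close> of the clusters converge geometrically: if \<open>E\<close> commutes with \<open>T\<close> and
  \<open>E' = S E S\<^sup>-\<^sup>1\<close>, then with \<open>F = E - E\<^sup>*\<close>, \<open>F' = E' - E'\<^sup>*\<close>, \<open>a = U\<^sup>* E U - E\<^sup>*\<close> and \<open>b = E - U\<^sup>* E\<^sup>* U\<close>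
  one has the exact identity \<open>4 \<parallel>F'\<parallel>\<^sup>2 = 4 \<parallel>F\<parallel>\<^sup>2 - \<parallel>F - U\<^sup>* F U\<parallel>\<^sup>2 - \<parallel>a - b\<parallel>\<^sup>2\<close>. The two subtracted terms
  control the commutator of \<open>T\<close> with \<open>F\<close>, which for an almost orthogonal idempotent close to a
  polynomial in \<open>T\<close> controls \<open>F\<close> itself. As the limit is \<open>\<Sum> \<lambda> E\<^sub>\<lambda>\<close>, it is attained locally uniformly.
\<close>

section \<open>The adjoint, the Frobenius inner product and the Frobenius norm\<close>

abbreviation cmat_adj :: "complex^'n^'n \<Rightarrow> complex^'n^'n" ("_\<^sup>H" [1000] 1000)
  where "A\<^sup>H \<equiv> adjoint_mat A"

lemma adjoint_adjoint [simp]: "A\<^sup>H\<^sup>H = A"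
  by (simp add: adjoint_mat_def vec_eq_iff)

lemma adjoint_mult: "(A ** B)\<^sup>H = B\<^sup>H ** A\<^sup>H"
  by (simp add: adjoint_mat_def matrix_matrix_mult_def vec_eq_iff mult.commute)

lemma adjoint_add: "(A + B)\<^sup>H = A\<^sup>H + B\<^sup>H"
  by (simp add: adjoint_mat_def vec_eq_iff)

lemma adjoint_diff: "(A - B)\<^sup>H = A\<^sup>H - B\<^sup>H"
  by (simp add: adjoint_mat_def vec_eq_iff)

lemma adjoint_mat: "(mat c)\<^sup>H = mat (cnj c)"
  by (simp add: adjoint_mat_def vec_eq_iff mat_def)

lemma adjoint_one [simp]: "(mat 1)\<^sup>H = mat 1"
  by (simp add: adjoint_mat)

lemma adjoint_scaleR: "(r *\<^sub>R A)\<^sup>H = r *\<^sub>R A\<^sup>H"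
  by (simp add: adjoint_mat_def vec_eq_iff)

lemma inner_complex_cnj: "x \<bullet> y = Re (cnj x * y)" for x y :: complex
  by (simp add: inner_complex_def)

text \<open>The inner product of the matrix type is the real part of
  \<open>trace (A\<^sup>H ** B)\<close>, so left multiplication by \<open>A\<close> has adjoint
  \<open>A\<^sup>H\<close>; the swaps only reorder the triple sum.\<close>

lemma inner_mat_mult_left: "(A ** B) \<bullet> C = B \<bullet> (A\<^sup>H ** C)" for A B C :: "complex^'n^'n"
proof -
  have "(A ** B) \<bullet> C = Re (\<Sum>i\<in>UNIV. \<Sum>j\<in>UNIV. \<Sum>k\<in>UNIV. cnj (A$i$k) * cnj (B$k$j) * C$i$j)"
    by (simp add: inner_vec_def inner_complex_cnj matrix_matrix_mult_def sum_distrib_right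
        sum_distrib_left)
  also have "(\<Sum>i\<in>UNIV. \<Sum>j\<in>UNIV. \<Sum>k\<in>UNIV. cnj (A$i$k) * cnj (B$k$j) * C$i$j)
     = (\<Sum>i\<in>UNIV. \<Sum>k\<in>UNIV. \<Sum>j\<in>UNIV. cnj (A$i$k) * cnj (B$k$j) * C$i$j)"
    by (intro sum.cong refl sum.swap)
  also have "\<dots> = (\<Sum>k\<in>UNIV. \<Sum>i\<in>UNIV. \<Sum>j\<in>UNIV. cnj (A$i$k) * cnj (B$k$j) * C$i$j)"
    by (rule sum.swap)
  also have "\<dots> = (\<Sum>k\<in>UNIV. \<Sum>j\<in>UNIV. \<Sum>i\<in>UNIV. cnj (A$i$k) * cnj (B$k$j) * C$i$j)"
    by (intro sum.cong refl sum.swap)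
  also have "Re \<dots> = B \<bullet> (A\<^sup>H ** C)"
    by (simp add: inner_vec_def inner_complex_cnj matrix_matrix_mult_def adjoint_mat_def
        sum_distrib_left mult_ac)
  finally show ?thesis .
qed

lemma inner_adjoint: "A\<^sup>H \<bullet> B\<^sup>H = A \<bullet> B" for A B :: "complex^'n^'n"
  unfolding inner_vec_def adjoint_mat_def
  by (subst sum.swap) (simp add: inner_complex_def)

lemma inner_mat_mult_right: "(A ** B) \<bullet> C = A \<bullet> (C ** B\<^sup>H)" for A B C :: "complex^'n^'n"
proof -
  have "(A ** B) \<bullet> C = (B\<^sup>H ** A\<^sup>H) \<bullet> C\<^sup>H"
    by (simp only: inner_adjoint flip: adjoint_mult)
  also have "\<dots> = A\<^sup>H \<bullet> (C ** B\<^sup>H)\<^sup>H"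
    by (simp only: inner_mat_mult_left adjoint_mult adjoint_adjoint)
  finally show ?thesis by (simp only: inner_adjoint)
qed

lemma norm_adjoint [simp]: "norm (A\<^sup>H) = norm A" for A :: "complex^'n^'n"
  by (simp add: norm_eq_sqrt_inner inner_adjoint)

lemma norm_mat_sq: "(norm A)\<^sup>2 = (\<Sum>i\<in>UNIV. \<Sum>j\<in>UNIV. (cmod (A$i$j))\<^sup>2)" for A :: "complex^'n^'m"
  by (simp add: norm_vec_def L2_set_def sum_nonneg)

text \<open>The norm is the Frobenius norm: Cauchy-Schwarz bounds each entry of the product, and
  summing the bounds factorises. The identity does not have norm 1 in general, hence the factors
  \<open>norm (mat 1)\<close> further on.\<close>

lemma norm_mat_mult_le: "norm (A ** B) \<le> norm A * norm B" for A B :: "complex^'n^'n"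
proof -
  have "(cmod ((A ** B)$i$j))\<^sup>2 \<le> (\<Sum>k\<in>UNIV. (cmod (A$i$k))\<^sup>2) * (\<Sum>k\<in>UNIV. (cmod (B$k$j))\<^sup>2)" for i j
  proof -
    have "cmod ((A ** B)$i$j) \<le> (\<Sum>k\<in>UNIV. cmod (A$i$k) * cmod (B$k$j))"
      by (auto simp: matrix_matrix_mult_def norm_mult intro!: sum_norm_le)
    then have "(cmod ((A ** B)$i$j))\<^sup>2 \<le> (\<Sum>k\<in>UNIV. cmod (A$i$k) * cmod (B$k$j))\<^sup>2"
      by (intro power_mono) auto
    also have "\<dots> \<le> (\<Sum>k\<in>UNIV. (cmod (A$i$k))\<^sup>2) * (\<Sum>k\<in>UNIV. (cmod (B$k$j))\<^sup>2)"
      by (rule Cauchy_Schwarz_ineq_sum)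
    finally show ?thesis .
  qed
  then have "(norm (A ** B))\<^sup>2 \<le> (\<Sum>i\<in>UNIV. \<Sum>j\<in>UNIV. (\<Sum>k\<in>UNIV. (cmod (A$i$k))\<^sup>2) * (\<Sum>k\<in>UNIV. (cmod (B$k$j))\<^sup>2))"
    unfolding norm_mat_sq by (intro sum_mono)
  also have "\<dots> = (norm A)\<^sup>2 * (\<Sum>j\<in>UNIV. \<Sum>k\<in>UNIV. (cmod (B$k$j))\<^sup>2)"
    unfolding norm_mat_sq
    by (simp only: sum_distrib_left[symmetric] sum_distrib_right[symmetric])
  also have "(\<Sum>j\<in>UNIV. \<Sum>k\<in>UNIV. (cmod (B$k$j))\<^sup>2) = (norm B)\<^sup>2"
    unfolding norm_mat_sq by (rule sum.swap)
  finally show ?thesis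
    by (metis norm_ge_zero power2_le_imp_le power_mult_distrib mult_nonneg_nonneg)
qed

lemma bounded_bilinear_mat_mult:
  "bounded_bilinear ((**) :: complex^'n^'n \<Rightarrow> complex^'n^'n \<Rightarrow> complex^'n^'n)"
proof (rule bounded_bilinear.intro)
  show "\<exists>K. \<forall>(A :: complex^'n^'n) (B :: complex^'n^'n). norm (A ** B) \<le> norm A * norm B * K"
    by (rule exI[of _ 1]) (simp add: norm_mat_mult_le)
qed (auto simp: matrix_matrix_mult_def vec_eq_iff algebra_simps sum.distrib scaleR_sum_right)

interpretation mm: bounded_bilinear "(**) :: complex^'n^'n \<Rightarrow> complex^'n^'n \<Rightarrow> complex^'n^'n"
  by (rule bounded_bilinear_mat_mult)

text \<open>Rewriting with these gives sums of left-nested products, after which noncommutative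
  identities are identities in an additive group.\<close>

lemmas mat_distrib = mm.add_left mm.add_right mm.diff_left mm.diff_right mm.minus_left mm.minus_right
  mm.scaleR_left mm.scaleR_right matrix_mul_assoc

lemma bounded_linear_adjoint: "bounded_linear (adjoint_mat :: complex^'n^'n \<Rightarrow> complex^'n^'n)"
  by (rule bounded_linear_intro[of _ 1]) (auto simp: adjoint_add adjoint_scaleR)

lemmas tendsto_adjoint = bounded_linear.tendsto[OF bounded_linear_adjoint]
lemmas continuous_on_adjoint = bounded_linear.continuous_on[OF bounded_linear_adjoint]

lemma mat_scalar_commute: "mat c ** A = A ** mat c" for A :: "complex^'n^'n"
  by (simp add: matrix_matrix_mult_def mat_def vec_eq_iff if_distrib[of "\<lambda>x. x * _"]
     if_distrib[of "\<lambda>x. _ * x"] cong: if_cong)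

lemma mat_add: "mat (a + b) = (mat a + mat b :: complex^'n^'n)"
  by (simp add: mat_def vec_eq_iff)

lemma mat_uminus: "mat (- a) = (- mat a :: complex^'n^'n)"
  by (simp add: mat_def vec_eq_iff)

lemma mat_mult: "mat (a * b) = (mat a ** mat b :: complex^'n^'n)"
  by (simp add: matrix_matrix_mult_def mat_def vec_eq_iff if_distrib[of "\<lambda>x. x * _"]
     if_distrib[of "\<lambda>x. _ * x"] cong: if_cong)

lemma mat_zero [simp]: "mat 0 = (0 :: complex^'n^'n)"
  by (simp add: mat_def vec_eq_iff)

lemma mat_inv_commute: "A ** B = mat 1 \<longleftrightarrow> B ** A = mat 1" for A B :: "complex^'n^'n"
  by (metis matrix_left_right_inverse)

subsection \<open>Polynomials of matrices\<close>

definition matpoly :: "complex poly \<Rightarrow> complex^'n^'n \<Rightarrow> complex^'n^'n" where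
  "matpoly p A = fold_coeffs (\<lambda>a M. mat a + A ** M) p 0"

lemma matpoly_0 [simp]: "matpoly 0 A = 0"
  by (simp add: matpoly_def)

lemma matpoly_pCons [simp]: "matpoly (pCons a p) A = mat a + A ** matpoly p A"
  by (cases "a = 0 \<and> p = 0") (auto simp: matpoly_def)

lemma matpoly_add: "matpoly (p + q) A = matpoly p A + matpoly q A"
  by (induction p q rule: poly_induct2) (auto simp: mat_add matrix_add_ldistrib)

lemma matpoly_smult: "matpoly (smult c p) A = mat c ** matpoly p A"
proof (induction p)
  case (pCons a p)
  then show ?case
    by (simp add: mat_mult matrix_add_ldistrib matrix_mul_assoc mat_scalar_commute[of c A])
qed auto

lemma matpoly_commute:
  assumes "A ** B = B ** A"
  shows "matpoly p A ** B = B ** matpoly p A"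
proof (induction p)
  case (pCons a p)
  then show ?case
    by (simp add: mm.add_left mm.add_right mat_scalar_commute assms matrix_mul_assoc[symmetric])
      (metis assms matrix_mul_assoc)
qed auto

text \<open>The linear factor stands on the right so that it acts first on a vector, as the search
  for an eigenvector requires.\<close>

lemma matpoly_linear_factor: "matpoly ([:-c, 1:] * q) A = matpoly q A ** (A - mat c)"
proof -
  have *: "[:-c, 1:] * q = pCons 0 q + smult (-c) q" by simp
  show ?thesis unfolding * matpoly_add matpoly_smult
    by (simp add: mat_distrib mat_uminus matpoly_commute[of A A] mat_scalar_commute[of c "matpoly q A"])
qed

lemma matpoly_similar:
  fixes A G G' :: "complex^'n^'n"
  assumes "G' ** G = mat 1"
  shows "matpoly p (G ** A ** G') = G ** matpoly p A ** G'"
proof -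
  have "G ** G' = mat 1" using assms mat_inv_commute by blast
  show ?thesis
  proof (induction p)
    case (pCons a p)
    have "G ** A ** G' ** (G ** matpoly p A ** G') = G ** A ** (G' ** G) ** matpoly p A ** G'"
      by (simp add: matrix_mul_assoc)
    moreover have "G ** mat a ** G' = mat a"
      by (metis \<open>G ** G' = mat 1\<close> mat_scalar_commute matrix_mul_assoc matrix_mul_rid)
    ultimately show ?case
      by (simp add: pCons assms mm.add_left mm.add_right matrix_mul_assoc)
  qed auto
qed

lemma continuous_on_matpoly [continuous_intros]:
  "continuous_on X f \<Longrightarrow> continuous_on X (\<lambda>x. matpoly p (f x :: complex^'n^'n))"
  by (induction p) (auto intro!: continuous_intros mm.continuous_on)

lemma tendsto_matpoly:
  "(f \<longlongrightarrow> A) F \<Longrightarrow> ((\<lambda>x. matpoly p (f x)) \<longlongrightarrow> matpoly p A) F" for A :: "complex^'n^'n"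
  by (induction p) (auto intro!: tendsto_intros mm.tendsto)

text \<open>A new node is served by adding a multiple of the product that vanishes at exactly the
  old nodes.\<close>

lemma poly_interpolation:
  fixes g :: "complex \<Rightarrow> complex"
  assumes "finite L"
  shows "\<exists>p. \<forall>z\<in>L. poly p z = g z"
  using assms
proof induction
  case (insert x L)
  then obtain p where p: "\<forall>z\<in>L. poly p z = g z" by blast
  define q where "q = (\<Prod>y\<in>L. [:-y, 1:])"
  have q0: "poly q z = 0" if "z \<in> L" for z
    using that insert by (auto simp: q_def poly_prod)
  have qx: "poly q x \<noteq> 0" using insert by (auto simp: q_def poly_prod)
  show ?case
    by (rule exI[of _ "p + smult ((g x - poly p x) / poly q x) q"])
      (use p q0 qx in auto)
qed auto

subsection \<open>The spectral theorem for normal matrices\<close>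

text \<open>The complex inner product, conjugate linear on the left; its real part is
  \<open>\<bullet>\<close>. Complex orthogonality is what the spectral theorem needs.\<close>

definition cinner :: "complex^'n \<Rightarrow> complex^'n \<Rightarrow> complex" where
  "cinner x y = (\<Sum>i\<in>UNIV. cnj (x $ i) * y $ i)"

lemma cinner_diff_right: "cinner x (y - z) = cinner x y - cinner x z"
  by (simp add: cinner_def right_diff_distrib sum_subtractf)

lemma cinner_scale_left: "cinner (c *s x) y = cnj c * cinner x y"
  by (simp add: cinner_def sum_distrib_left mult_ac)

lemma cinner_scale_right: "cinner x (c *s y) = c * cinner x y"
  by (simp add: cinner_def sum_distrib_left mult_ac)

lemma cnj_cinner: "cnj (cinner x y) = cinner y x"
  by (simp add: cinner_def mult.commute)

lemma inner_eq_Re_cinner: "x \<bullet> y = Re (cinner x y)" for x y :: "complex^'n"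
  by (simp add: cinner_def inner_vec_def inner_complex_cnj)

lemma cinner_self: "cinner x x = of_real ((norm x)\<^sup>2)"
proof -
  have "Im (cinner x x) = 0"
    by (simp add: cinner_def mult.commute)
  moreover have "Re (cinner x x) = (norm x)\<^sup>2"
    by (simp add: power2_norm_eq_inner inner_eq_Re_cinner)
  ultimately show ?thesis by (simp add: complex_eq_iff)
qed

lemma cinner_mult_right: "cinner x (A *v y) = cinner (A\<^sup>H *v x) y"
proof -
  have "cinner x (A *v y) = (\<Sum>i\<in>UNIV. \<Sum>j\<in>UNIV. cnj (x $ i) * A $ i $ j * y $ j)"
    by (simp add: cinner_def matrix_vector_mult_def sum_distrib_left mult_ac)
  also have "\<dots> = (\<Sum>j\<in>UNIV. \<Sum>i\<in>UNIV. cnj (x $ i) * A $ i $ j * y $ j)"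
    by (rule sum.swap)
  also have "\<dots> = cinner (A\<^sup>H *v x) y"
    by (simp add: cinner_def matrix_vector_mult_def adjoint_mat_def sum_distrib_left
        sum_distrib_right mult_ac)
  finally show ?thesis .
qed

lemma mat_vector_mult: "mat c *v x = c *s x" for x :: "complex^'n"
  by (simp add: matrix_vector_mult_def mat_def vec_eq_iff if_distrib[of "\<lambda>x. x * _"] cong: if_cong)

lemma matpoly_sum: "matpoly (\<Sum>i\<in>I. p i) A = (\<Sum>i\<in>I. matpoly (p i) A)"
  by (induction I rule: infinite_finite_induct) (auto simp: matpoly_add)

text \<open>The powers \<open>B 0\<close>, ..., \<open>B D\<close> are one more than the real
  dimension of the matrix space, so a real linear relation holds among them.\<close>

lemma annihilating_poly:
  fixes A :: "complex^'n^'n"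
  shows "\<exists>p. p \<noteq> 0 \<and> matpoly p A = 0"
proof -
  define B where "B k = matpoly (monom 1 k) A" for k
  define D where "D = DIM(complex^'n^'n)"
  show ?thesis
  proof (cases "inj_on B {..D}")
    \<comment> \<open>Dependence is a property of the set of powers, which loses members when two
      powers agree; then the difference of the two monomials annihilates \<open>A\<close>.\<close>
    case False
    then obtain j k where jk: "B j = B k" "j \<noteq> k" by (auto simp: inj_on_def)
    let ?p = "monom 1 j + smult (-1) (monom 1 k) :: complex poly"
    have "coeff ?p j = 1" using jk by simp
    then have "?p \<noteq> 0" by (metis coeff_0 zero_neq_one)
    moreover have "matpoly ?p A = 0"
      using jk by (simp only: matpoly_add matpoly_smult mat_uminus) (simp add: B_def mm.minus_left)
    ultimately show ?thesis by blast
  next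
    case True
    have "card (B ` {..D}) > DIM(complex^'n^'n)"
      using True by (simp add: card_image D_def)
    then have "dependent (B ` {..D})"
      by (intro dependent_biggerset) auto
    then obtain u where u: "\<exists>v\<in>B ` {..D}. u v \<noteq> 0" "(\<Sum>v\<in>B ` {..D}. u v *\<^sub>R v) = 0"
      using real_vector.dependent_finite[of "B ` {..D}"] by auto
    define p :: "complex poly" where "p = (\<Sum>k\<le>D. smult (of_real (u (B k))) (monom 1 k))"
    have "coeff p k = of_real (u (B k))" if "k \<le> D" for k
      using that by (simp add: p_def coeff_sum if_distrib[of "\<lambda>x. _ * x"] cong: if_cong)
    then have "p \<noteq> 0" using u(1) by force
    moreover have "matpoly p A = (\<Sum>k\<le>D. u (B k) *\<^sub>R B k)"
    proof -
      have "mat (of_real r) ** X = r *\<^sub>R X" for r and X :: "complex^'n^'n"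
        by (simp add: matrix_matrix_mult_def mat_def vec_eq_iff scaleR_conv_of_real[where 'a=complex]
            if_distrib[of "\<lambda>x. x * _"] cong: if_cong)
      then show ?thesis by (simp add: p_def matpoly_sum matpoly_smult B_def)
    qed
    ultimately show ?thesis
      using u(2) True by (auto simp: sum.reindex intro!: exI[of _ p])
  qed
qed

text \<open>Linear factors of an annihilating polynomial are applied to \<open>x\<close> one at a
  time. The last nonzero vector before some factor \<open>A - mat c\<close> kills it is an
  eigenvector, and all these vectors stay in \<open>V\<close>.\<close>

lemma eigenvector_in_invariant:
  fixes A :: "complex^'n^'n"
  assumes inv: "\<And>c x. x \<in> V \<Longrightarrow> (A - mat c) *v x \<in> V"
    and x: "x \<in> V" "x \<noteq> 0"
  shows "\<exists>y\<in>V. \<exists>c. y \<noteq> 0 \<and> A *v y = c *s y"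
proof -
  obtain p where p: "p \<noteq> 0" "matpoly p A = 0"
    using annihilating_poly by blast
  have "\<exists>y\<in>V. \<exists>c. y \<noteq> 0 \<and> A *v y = c *s y"
    if "degree p = n" "p \<noteq> 0" "matpoly p A *v x = 0" "x \<in> V" "x \<noteq> 0" for n p x
    using that
  proof (induction n arbitrary: p x)
    case 0
    then obtain a where "p = [:a:]" "a \<noteq> 0" by (metis degree_eq_zeroE pCons_0_0)
    then show ?case using 0 by (simp add: mat_vector_mult)
  next
    case (Suc n)
    then obtain c where "poly p c = 0"
      using fundamental_theorem_of_algebra[of p] by (auto simp: constant_degree)
    then obtain q where q: "p = [:-c, 1:] * q" by (auto simp: poly_eq_0_iff_dvd)
    define y where "y = (A - mat c) *v x"
    show ?case
    proof (cases "y = 0")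
      case True
      then have "A *v x = c *s x"
        by (simp add: y_def matrix_vector_mult_diff_rdistrib mat_vector_mult)
      then show ?thesis using Suc.prems by blast
    next
      case False
      have "q \<noteq> 0" using q Suc.prems by auto
      then have "degree q = n" using Suc.prems q by (simp add: degree_mult_eq del: mult_pCons_left)
      moreover have "matpoly q A *v y = 0"
        using Suc.prems(3) unfolding q matpoly_linear_factor
        by (simp add: y_def matrix_vector_mul_assoc)
      moreover have "y \<in> V" using Suc.prems inv by (simp add: y_def)
      ultimately show ?thesis using Suc.IH False \<open>q \<noteq> 0\<close> by blast
    qed
  qed
  then show ?thesis using p x by simp
qed

definition normal_mat :: "complex^'n^'n \<Rightarrow> bool" where
  "normal_mat A \<longleftrightarrow> A\<^sup>H ** A = A ** A\<^sup>H"

text \<open>\<open>B = A - mat c\<close> is normal too, so \<open>B\<close> and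
  \<open>B\<^sup>H\<close> send \<open>x\<close> to vectors of equal norm, here 0.\<close>

lemma normal_eigenvector_adjoint:
  assumes "normal_mat A" "A *v x = c *s x"
  shows "A\<^sup>H *v x = cnj c *s x"
proof -
  define B where "B = A - mat c"
  have BH: "B\<^sup>H = A\<^sup>H - mat (cnj c)" by (simp add: B_def adjoint_diff adjoint_mat)
  have "B\<^sup>H ** B = B ** B\<^sup>H"
    using assms(1) unfolding BH normal_mat_def unfolding B_def
    by (simp add: mat_distrib mat_scalar_commute[of c "A\<^sup>H"] mat_scalar_commute[of "cnj c" A]
        mat_scalar_commute[of "cnj c" "mat c"])
  then have "cinner (B\<^sup>H *v x) (B\<^sup>H *v x) = cinner (B *v x) (B *v x)"
    by (metis adjoint_adjoint cinner_mult_right matrix_vector_mul_assoc)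
  moreover have "B *v x = 0"
    using assms(2) by (simp add: B_def matrix_vector_mult_diff_rdistrib mat_vector_mult)
  ultimately have "B\<^sup>H *v x = 0" by (simp add: cinner_self)
  then show ?thesis
    by (simp add: BH matrix_vector_mult_diff_rdistrib mat_vector_mult)
qed

text \<open>The square matrix with rows the conjugates of \<open>v i\<close> for \<open>i\<close> in
  \<open>I\<close> has a zero row at \<open>i0\<close>, so it is singular and its kernel provides
  the vector.\<close>

lemma exists_orthogonal_vector:
  fixes v :: "'n \<Rightarrow> complex^'n"
  assumes "i0 \<notin> I"
  shows "\<exists>x. x \<noteq> 0 \<and> (\<forall>i\<in>I. cinner (v i) x = 0)"
proof -
  define M :: "complex^'n^'n" where "M = (\<chi> r c. if r \<in> I then cnj (v r $ c) else 0)"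
  have "\<not> (\<exists>B. B ** M = mat 1)"
  proof
    assume "\<exists>B. B ** M = mat 1"
    then obtain B where "M ** B = mat 1" using mat_inv_commute by blast
    then have "(M ** B) $ i0 $ i0 = 1" by (simp add: mat_def)
    then show False using assms by (simp add: M_def matrix_matrix_mult_def)
  qed
  then obtain x where x: "M *v x = 0" "x \<noteq> 0"
    by (auto simp: matrix_left_invertible_ker)
  have "cinner (v i) x = 0" if "i \<in> I" for i
  proof -
    have "(M *v x) $ i = 0" using x by simp
    then show ?thesis using that by (simp add: M_def matrix_vector_mult_def cinner_def)
  qed
  then show ?thesis using x by blast
qed

text \<open>Eigenvectors are added one index at a time. The orthogonal complement of those already
  found is invariant under \<open>A\<close> because, by normality, they are eigenvectors of the
  adjoint as well.\<close>

lemma orthonormal_eigenvectors: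
  fixes A :: "complex^'n^'n" and I :: "'n set"
  assumes A: "normal_mat A" and "finite I"
  shows "\<exists>v d. (\<forall>i\<in>I. \<forall>j\<in>I. cinner (v i) (v j) = (if i = j then 1 else 0)) \<and>
           (\<forall>i\<in>I. A *v v i = d i *s v i)"
  using assms(2)
proof induction
  case (insert i0 I)
  then obtain v d where v: "\<And>i j. i \<in> I \<Longrightarrow> j \<in> I \<Longrightarrow> cinner (v i) (v j) = (if i = j then 1 else 0)"
    and d: "\<And>i. i \<in> I \<Longrightarrow> A *v v i = d i *s v i" by blast
  define V where "V = {x. \<forall>i\<in>I. cinner (v i) x = 0}"
  obtain x where "x \<in> V" "x \<noteq> 0"
    using exists_orthogonal_vector[OF insert(2)] V_def by blast
  moreover have "(A - mat c) *v x \<in> V" if "x \<in> V" for c x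
    using that normal_eigenvector_adjoint[OF A d]
    by (simp add: V_def matrix_vector_mult_diff_rdistrib mat_vector_mult cinner_diff_right
        cinner_scale_right cinner_mult_right cinner_scale_left)
  ultimately obtain y c where y: "y \<in> V" "y \<noteq> 0" "A *v y = c *s y"
    using eigenvector_in_invariant by metis
  define z where "z = of_real (1 / norm y) *s y"
  have zz: "cinner z z = 1"
    using y unfolding z_def cinner_scale_left cinner_scale_right cinner_self[of y]
    by (simp add: power2_eq_square)
  have Az: "A *v z = c *s z"
    by (simp add: z_def y vec.scale mult.commute)
  have vz: "cinner (v i) z = 0" if "i \<in> I" for i
    using y that by (simp add: z_def V_def cinner_scale_right)
  have zv: "cinner z (v i) = 0" if "i \<in> I" for i
    using vz[OF that] cnj_cinner[of "v i" z] by simp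
  define w where "w = v(i0 := z)"
  define e where "e = d(i0 := c)"
  have w0: "w i0 = z" "e i0 = c" by (auto simp: w_def e_def)
  have w1: "w i = v i" "e i = d i" if "i \<in> I" for i
    using that insert(2) by (auto simp: w_def e_def)
  have "cinner (w i) (w j) = (if i = j then 1 else 0)"
    if "i \<in> insert i0 I" "j \<in> insert i0 I" for i j
    using that w0 w1 insert(2) v[of i j] zz vz[of i] zv[of j] by (cases "i = i0"; cases "j = i0") auto
  moreover have "A *v w i = e i *s w i" if "i \<in> insert i0 I" for i
    using that w0 w1 d Az by (cases "i = i0") auto
  ultimately show ?case by blast
qed auto

definition diag_mat :: "('n \<Rightarrow> complex) \<Rightarrow> complex^'n^'n" where
  "diag_mat d = (\<chi> i j. if i = j then d i else 0)"

theorem normal_mat_diagonalization: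
  fixes A :: "complex^'n^'n"
  assumes "normal_mat A"
  obtains V d where "unitary_mat V" "A = V ** diag_mat d ** V\<^sup>H"
proof -
  obtain v :: "'n \<Rightarrow> complex^'n" and d where v: "\<forall>i j. cinner (v i) (v j) = (if i = j then 1 else 0)"
    and d: "\<forall>i. A *v v i = d i *s v i"
    using orthonormal_eigenvectors[OF assms finite[of UNIV]] by auto
  define V where "V = (\<chi> i j. v j $ i)"
  have "V\<^sup>H ** V = mat 1"
    using v by (simp add: V_def adjoint_mat_def matrix_matrix_mult_def mat_def vec_eq_iff cinner_def)
  then have V: "unitary_mat V" by (simp add: unitary_mat_def mat_inv_commute)
  have "A ** V = V ** diag_mat d"
    using d by (simp add: V_def diag_mat_def matrix_matrix_mult_def matrix_vector_mult_def vec_eq_iff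
        if_distrib[of "\<lambda>x. _ * x"] mult.commute cong: if_cong)
  then have "A = V ** diag_mat d ** V\<^sup>H"
    using V by (metis matrix_mul_assoc matrix_mul_rid unitary_mat_def)
  with V that show ?thesis by blast
qed

subsection \<open>Positive semidefinite matrices\<close>

lemma inner_mat_vec_left: "(A *v x) \<bullet> y = x \<bullet> (A\<^sup>H *v y)" for A :: "complex^'n^'n"
  by (simp add: inner_eq_Re_cinner cinner_mult_right)

lemma psd_mat_iff: "psd_mat A \<longleftrightarrow> A\<^sup>H = A \<and> (\<forall>x. 0 \<le> x \<bullet> (A *v x))"
  by (simp add: psd_mat_def hermitian_mat_def inner_eq_Re_cinner cinner_def)

lemma psd_adjoint: "psd_mat A \<Longrightarrow> A\<^sup>H = A"
  by (simp add: psd_mat_iff)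

lemma psd_congruence:
  assumes "psd_mat A" shows "psd_mat (G ** A ** G\<^sup>H)"
proof -
  have "x \<bullet> ((G ** A ** G\<^sup>H) *v x) = (G\<^sup>H *v x) \<bullet> (A *v (G\<^sup>H *v x))" for x
    by (simp add: inner_mat_vec_left matrix_vector_mul_assoc matrix_mul_assoc)
  then show ?thesis using assms
    by (simp add: psd_mat_iff adjoint_mult matrix_mul_assoc)
qed

lemma psd_adjoint_mult: "psd_mat (A\<^sup>H ** A)"
proof -
  have "psd_mat (mat 1)" by (simp add: psd_mat_iff)
  from psd_congruence[OF this, of "A\<^sup>H"] show ?thesis by simp
qed

lemma psd_diag:
  fixes d :: "'n::finite \<Rightarrow> real"
  assumes d: "\<And>i. d i \<ge> 0"
  shows "psd_mat (diag_mat (\<lambda>i. of_real (d i)))"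
proof -
  have *: "diag_mat (\<lambda>i. of_real (d i)) *v x = (\<chi> i. of_real (d i) * x $ i)" for x :: "complex^'n"
    by (simp add: diag_mat_def matrix_vector_mult_def vec_eq_iff if_distrib[of "\<lambda>x. x * _"] cong: if_cong)
  show ?thesis unfolding psd_mat_iff *
    using d by (auto simp: diag_mat_def adjoint_mat_def vec_eq_iff inner_vec_def
        scaleR_conv_of_real[symmetric] intro!: sum_nonneg)
qed

text \<open>The inner product splits into the values of the quadratic form of \<open>A\<close> at
  the columns of \<open>X\<close>.\<close>

lemma inner_psd_mult_left:
  fixes A X :: "complex^'n^'n"
  assumes "psd_mat A" shows "0 \<le> X \<bullet> (A ** X)"
proof -
  have "X \<bullet> (A ** X) = (\<Sum>i\<in>UNIV. \<Sum>j\<in>UNIV. X$i$j \<bullet> (A ** X)$i$j)"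
    by (simp add: inner_vec_def)
  also have "\<dots> = (\<Sum>j\<in>UNIV. \<Sum>i\<in>UNIV. X$i$j \<bullet> (A ** X)$i$j)"
    by (rule sum.swap)
  also have "\<dots> = (\<Sum>j\<in>UNIV. (\<chi> i. X$i$j) \<bullet> (A *v (\<chi> i. X$i$j)))"
    by (simp add: inner_vec_def matrix_matrix_mult_def matrix_vector_mult_def)
  finally show ?thesis using assms by (auto simp: psd_mat_iff intro!: sum_nonneg)
qed

lemma diag_mat_mult: "diag_mat c ** diag_mat d = diag_mat (\<lambda>i. c i * d i)"
  by (simp add: diag_mat_def matrix_matrix_mult_def vec_eq_iff if_distrib[of "\<lambda>x. x * _"] cong: if_cong)

lemma adjoint_diag_mat: "(diag_mat d)\<^sup>H = diag_mat (\<lambda>i. cnj (d i))"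
  by (auto simp: diag_mat_def adjoint_mat_def vec_eq_iff)

lemma unitary_conj_mult:
  assumes "unitary_mat V"
  shows "(V ** A ** V\<^sup>H) ** (V ** B ** V\<^sup>H) = V ** (A ** B) ** V\<^sup>H"
proof -
  have "(V ** A ** V\<^sup>H) ** (V ** B ** V\<^sup>H) = V ** A ** (V\<^sup>H ** V) ** B ** V\<^sup>H"
    by (simp add: matrix_mul_assoc)
  also have "V\<^sup>H ** V = mat 1" using assms by (simp add: unitary_mat_def)
  finally show ?thesis by (simp add: matrix_mul_assoc)
qed

lemma psd_sqrt_exists:
  assumes A: "psd_mat A"
  shows "\<exists>B. psd_mat B \<and> B ** B = A"
proof -
  have "normal_mat A" using A by (simp add: normal_mat_def psd_adjoint)
  then obtain V d where V: "unitary_mat V" and AV: "A = V ** diag_mat d ** V\<^sup>H"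
    using normal_mat_diagonalization by metis
  have VV: "V\<^sup>H ** V = mat 1" using V by (simp add: unitary_mat_def)
  have D: "diag_mat d = V\<^sup>H ** A ** V\<^sup>H\<^sup>H"
  proof -
    have "V\<^sup>H ** A ** V\<^sup>H\<^sup>H = (V\<^sup>H ** V) ** diag_mat d ** (V\<^sup>H ** V)"
      by (simp add: AV matrix_mul_assoc)
    then show ?thesis by (simp add: VV)
  qed
  \<comment> \<open>The diagonal matrix is a congruence transform of \<open>A\<close>, so it is
    positive semidefinite; testing it on the axis vectors makes its entries real and
    nonnegative.\<close>
  have psdD: "psd_mat (diag_mat d)" unfolding D by (rule psd_congruence[OF A])
  have d: "d i = of_real (Re (d i)) \<and> Re (d i) \<ge> 0" for i
  proof
    have "(diag_mat d)\<^sup>H $ i $ i = diag_mat d $ i $ i" using psdD by (simp add: psd_adjoint)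
    then show "d i = of_real (Re (d i))"
      unfolding adjoint_diag_mat by (auto simp: diag_mat_def complex_eq_iff)
    have "0 \<le> axis i 1 \<bullet> (diag_mat d *v axis i 1)" using psdD by (simp add: psd_mat_iff)
    then show "Re (d i) \<ge> 0"
      by (simp add: inner_axis' matrix_vector_mult_def diag_mat_def axis_def inner_vec_def
          if_distrib[of "\<lambda>x. x * _"] if_distrib[of "\<lambda>x. _ * x"] if_distrib[of "\<lambda>x. x \<bullet> _"]
          if_distrib[of "\<lambda>x. _ \<bullet> x"] cong: if_cong)
  qed
  define B where "B = V ** diag_mat (\<lambda>i. of_real (sqrt (Re (d i)))) ** V\<^sup>H"
  have "psd_mat B" unfolding B_def
    by (intro psd_congruence psd_diag) (use d in auto)
  moreover have "B ** B = A"
  proof -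
    have "(\<lambda>i. complex_of_real (sqrt (Re (d i))) * of_real (sqrt (Re (d i)))) = d"
    proof
      fix i
      have "complex_of_real (sqrt (Re (d i))) * of_real (sqrt (Re (d i))) = of_real (Re (d i))"
        using d[of i] by (simp flip: of_real_mult)
      then show "complex_of_real (sqrt (Re (d i))) * of_real (sqrt (Re (d i))) = d i"
        using d[of i] by simp
    qed
    then show ?thesis by (simp add: B_def unitary_conj_mult[OF V] diag_mat_mult AV)
  qed
  ultimately show ?thesis by blast
qed

lemma inner_self_mult: "D \<bullet> (A\<^sup>H ** A ** D) = (norm (A ** D))\<^sup>2" for A D :: "complex^'n^'n"
  by (simp add: power2_norm_eq_inner inner_mat_mult_left matrix_mul_assoc)

text \<open>With a positive root \<open>P\<close> of \<open>A\<close>, the inner product is the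
  square of the norm of \<open>P ** X\<close>.\<close>

lemma inner_psd_eq_0:
  fixes A X :: "complex^'n^'n"
  assumes "psd_mat A" "X \<bullet> (A ** X) = 0"
  shows "A ** X = 0"
proof -
  obtain P where P: "psd_mat P" "P ** P = A" using psd_sqrt_exists assms by blast
  then have "(norm (P ** X))\<^sup>2 = 0" using assms(2) inner_self_mult[of X P]
    by (simp add: psd_adjoint)
  then show ?thesis using P by (metis matrix_mul_assoc mm.zero_right norm_eq_zero power_eq_0_iff)
qed

text \<open>For \<open>D = B - C\<close>, equality of the squares gives
  \<open>B ** D + D ** C = 0\<close>. Paired with \<open>D\<close> this is a sum of two nonnegative
  terms, so both vanish, whence \<open>D ** D = 0\<close> and, \<open>D\<close> being Hermitian,
  \<open>D = 0\<close>.\<close>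

lemma psd_sqrt_unique:
  assumes B: "psd_mat B" and C: "psd_mat C" and BC: "B ** B = C ** C"
  shows "B = C"
proof -
  define D where "D = B - C"
  have DH: "D\<^sup>H = D" using B C by (simp add: D_def adjoint_diff psd_adjoint)
  have "B ** D + D ** C = 0" using BC by (simp add: D_def mat_distrib)
  then have "D \<bullet> (B ** D) + D \<bullet> (D ** C) = 0" by (metis inner_add_right inner_zero_right)
  moreover have "D \<bullet> (D ** C) = D \<bullet> (C ** D)"
    using inner_adjoint[of D "D ** C"] C DH by (simp add: adjoint_mult psd_adjoint)
  ultimately have "D \<bullet> (B ** D) = 0" "D \<bullet> (C ** D) = 0"
    using inner_psd_mult_left[OF B, of D] inner_psd_mult_left[OF C, of D] by linarith+
  then have "B ** D = 0" "C ** D = 0" using B C inner_psd_eq_0 by blast+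
  then have "D ** D = 0" by (simp add: D_def mm.diff_left)
  then have "D \<bullet> D = 0"
    using inner_mat_mult_left[of D "mat 1" D] DH by simp
  then show ?thesis by (simp add: D_def)
qed

lemma psd_sqrt:
  assumes "psd_mat A"
  shows "psd_mat (psd_sqrt A)" "psd_sqrt A ** psd_sqrt A = A"
proof -
  have "\<exists>!B. psd_mat B \<and> B ** B = A"
    using psd_sqrt_exists[OF assms] psd_sqrt_unique by metis
  from theI'[OF this] show "psd_mat (psd_sqrt A)" "psd_sqrt A ** psd_sqrt A = A"
    by (auto simp: psd_sqrt_def)
qed

subsection \<open>The Aluthge transform of an invertible matrix\<close>

lemma matrix_inv_mult:
  assumes "invertible A" shows "A ** matrix_inv A = mat 1" "matrix_inv A ** A = mat 1"
  using someI_ex[OF assms[unfolded invertible_def]] by (simp_all add: matrix_inv_def)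

lemma matrix_inv_eqI:
  fixes A B :: "complex^'n^'n"
  assumes "A ** B = mat 1" shows "invertible A" "matrix_inv A = B"
proof -
  show A: "invertible A" using assms mat_inv_commute invertible_def by blast
  show "matrix_inv A = B"
    by (metis A assms matrix_inv_mult(2) matrix_mul_assoc matrix_mul_lid matrix_mul_rid)
qed

lemma mult_cancel_left:
  assumes "B ** A = mat 1" shows "X ** B ** A = X"
  using assms by (simp flip: matrix_mul_assoc)

lemma unitary_norm_left: "unitary_mat U \<Longrightarrow> norm (U ** X) = norm X" for X U :: "complex^'n^'n"
  by (simp add: norm_eq_sqrt_inner inner_mat_mult_left matrix_mul_assoc unitary_mat_def)

lemma unitary_adjoint: "unitary_mat U \<Longrightarrow> unitary_mat (U\<^sup>H)"
  by (simp add: unitary_mat_def)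

lemma unitary_norm_right: "unitary_mat U \<Longrightarrow> norm (X ** U) = norm X" for X U :: "complex^'n^'n"
  using unitary_norm_left[OF unitary_adjoint, of U "X\<^sup>H"] by (simp flip: adjoint_mult)

text \<open>The positive factor is recorded through its square root: \<open>S = |T|\<^sup>1\<^sup>/\<^sup>2\<close>.\<close>

definition polar :: "complex^'n^'n \<Rightarrow> complex^'n^'n \<Rightarrow> complex^'n^'n \<Rightarrow> bool" where
  "polar T S U \<longleftrightarrow> psd_mat S \<and> invertible S \<and> unitary_mat U \<and> T = U ** S ** S"

lemma polarD:
  assumes "polar T S U"
  shows "psd_mat S" "invertible S" "unitary_mat U" "T = U ** S ** S" "S\<^sup>H = S"
    "U\<^sup>H ** U = mat 1" "U ** U\<^sup>H = mat 1" "matrix_inv S ** S = mat 1" "S ** matrix_inv S = mat 1"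
  using assms by (auto simp: polar_def psd_adjoint unitary_mat_def matrix_inv_mult)

lemma psd_square: "psd_mat S \<Longrightarrow> psd_mat (S ** S)"
  using psd_adjoint_mult[of S] by (simp add: psd_adjoint)

lemma polar_adjoint_mult:
  assumes "polar T S U" shows "T\<^sup>H ** T = (S ** S) ** (S ** S)"
proof -
  note p = polarD[OF assms]
  have "T\<^sup>H ** T = S ** S ** U\<^sup>H ** U ** S ** S"
    by (simp add: p(4) p(5) adjoint_mult matrix_mul_assoc)
  then show ?thesis by (simp add: mult_cancel_left[OF p(6)] matrix_mul_assoc)
qed

text \<open>\<open>T\<^sup>H ** T\<close> is the fourth power of \<open>S\<close>, so two uniqueness
  steps for square roots determine \<open>S\<close>; cancelling \<open>S\<close> then determines
  \<open>U\<close>.\<close>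

lemma polar_unique:
  assumes "polar T S U" "polar T S' U'"
  shows "S = S'" "U = U'"
proof -
  have "S ** S = S' ** S'"
    using polar_adjoint_mult[OF assms(1)] polar_adjoint_mult[OF assms(2)]
    by (intro psd_sqrt_unique[of "S ** S" "S' ** S'"] psd_square polarD(1)[OF assms(1)] polarD(1)[OF assms(2)]) simp
  then show S: "S = S'"
    by (rule psd_sqrt_unique[OF polarD(1)[OF assms(1)] polarD(1)[OF assms(2)]])
  have "U ** S ** S ** matrix_inv S ** matrix_inv S = U' ** S ** S ** matrix_inv S ** matrix_inv S"
    using polarD(4)[OF assms(1)] polarD(4)[OF assms(2)] S by simp
  then show "U = U'" by (simp add: mult_cancel_left polarD(9)[OF assms(1)])
qed

text \<open>This links the chosen unitary in \<open>aluthge\<close> with \<open>polar\<close>: once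
  some unitary factor is known to exist, the chosen one is a polar factor as well.\<close>

lemma polar_exists:
  fixes T :: "complex^'n^'n"
  assumes "invertible T"
  shows "\<exists>S U. polar T S U \<and> aluthge T = S ** U ** S"
proof -
  define H where "H = mat_abs T"
  have H: "psd_mat H" "H ** H = T\<^sup>H ** T"
    using psd_sqrt[OF psd_adjoint_mult[of T]] by (simp_all add: H_def mat_abs_def)
  define S where "S = psd_sqrt H"
  have S: "psd_mat S" "S ** S = H"
    using psd_sqrt[OF H(1)] by (simp_all add: S_def)
  define R where "R = matrix_inv T"
  have TR: "T ** R = mat 1" "R ** T = mat 1"
    using matrix_inv_mult[OF assms] by (simp_all add: R_def)
  have RT: "R\<^sup>H ** T\<^sup>H = mat 1" using TR(1) by (metis adjoint_mult adjoint_one)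
  have "R ** R\<^sup>H ** (H ** H) = mat 1"
    unfolding H(2) by (simp add: matrix_mul_assoc mult_cancel_left RT TR)
  then have Hinv: "R ** R\<^sup>H ** H ** H = mat 1" by (simp add: matrix_mul_assoc)
  \<comment> \<open>\<open>K\<close> is the inverse of \<open>H = |T|\<close>, since
    \<open>R ** R\<^sup>H\<close> inverts \<open>T\<^sup>H ** T = H ** H\<close>; the unitary factor
    is then \<open>T ** K\<close>.\<close>
  define K where "K = R ** R\<^sup>H ** H"
  have K: "K ** H = mat 1" "H ** K = mat 1"
    using Hinv mat_inv_commute by (simp_all add: K_def, blast)
  have KH: "K\<^sup>H ** H = mat 1"
    using K(2) H(1) by (metis adjoint_mult adjoint_one psd_adjoint)
  have "invertible S"
  proof -
    have "K ** S ** S = mat 1" using K S by (simp flip: matrix_mul_assoc)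
    then show ?thesis using mat_inv_commute invertible_def by blast
  qed
  have "unitary_mat (T ** K)"
  proof -
    have "(T ** K)\<^sup>H ** (T ** K) = K\<^sup>H ** (T\<^sup>H ** T) ** K"
      by (simp add: adjoint_mult matrix_mul_assoc)
    also have "\<dots> = K\<^sup>H ** H ** (H ** K)" by (simp add: matrix_mul_assoc flip: H(2))
    finally show ?thesis using KH K by (simp add: unitary_mat_def mat_inv_commute)
  qed
  moreover have "T = T ** K ** H" by (simp add: mult_cancel_left K)
  ultimately have ex: "\<exists>U. unitary_mat U \<and> T = U ** mat_abs T" unfolding H_def by blast
  define U where "U = (SOME U. unitary_mat U \<and> T = U ** mat_abs T)"
  have U: "unitary_mat U" "T = U ** H"
    using someI_ex[OF ex] by (simp_all add: U_def H_def)
  have "aluthge T = S ** U ** S"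
    by (simp add: aluthge_def U_def S_def H_def Let_def)
  moreover have "polar T S U"
    using U S \<open>invertible S\<close> by (simp add: polar_def flip: matrix_mul_assoc)
  ultimately show ?thesis by blast
qed

lemma polar_invertible:
  assumes "polar T S U" shows "invertible T"
  unfolding polarD(4)[OF assms]
  by (intro invertible_mult) (use polarD[OF assms] in \<open>auto simp: invertible_def\<close>)

lemma aluthge_polar:
  assumes "polar T S U" shows "aluthge T = S ** U ** S"
  using polar_exists[OF polar_invertible[OF assms]] polar_unique[OF assms] by metis

lemma aluthge_similar:
  assumes "polar T S U" shows "aluthge T = S ** T ** matrix_inv S"
  unfolding aluthge_polar[OF assms]
  by (simp add: polarD(4)[OF assms] matrix_mul_assoc mult_cancel_left polarD(9)[OF assms])

lemma aluthge_inverse: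
  assumes "polar T S U"
  shows "invertible (aluthge T)"
    "matrix_inv (aluthge T) = matrix_inv S ** U\<^sup>H ** matrix_inv S"
    "matrix_inv T = matrix_inv S ** matrix_inv S ** U\<^sup>H"
proof -
  note p = polarD[OF assms]
  have "aluthge T ** (matrix_inv S ** U\<^sup>H ** matrix_inv S) = mat 1"
    by (simp add: aluthge_polar[OF assms] matrix_mul_assoc mult_cancel_left p(6-9))
  from matrix_inv_eqI[OF this] show "invertible (aluthge T)"
    "matrix_inv (aluthge T) = matrix_inv S ** U\<^sup>H ** matrix_inv S" .
  have "T ** (matrix_inv S ** matrix_inv S ** U\<^sup>H) = mat 1"
    by (simp add: p(4) matrix_mul_assoc mult_cancel_left p(6-9))
  from matrix_inv_eqI[OF this] show "matrix_inv T = matrix_inv S ** matrix_inv S ** U\<^sup>H" by simp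
qed

section \<open>Monotonicity of norms under the transform, with equality only at normal
  matrices\<close>

lemma polar_inv_adjoint:
  assumes "polar T S U" shows "(matrix_inv S)\<^sup>H = matrix_inv S"
  by (metis adjoint_mult adjoint_one assms matrix_inv_eqI(2) polarD(5,8))

text \<open>Moving factors across the inner product turns the squared norm of
  \<open>S ** U ** S\<close> into the inner product of \<open>S ** S ** U\<close> and
  \<open>U ** S ** S\<close>. Both have the norm of \<open>T\<close>, so the loss is half their
  squared distance.\<close>

lemma norm_aluthge:
  assumes "polar T S U"
  shows "(norm (aluthge T))\<^sup>2 = (norm T)\<^sup>2 - (norm (S ** S ** U - U ** S ** S))\<^sup>2 / 2"
proof -
  note p = polarD[OF assms]
  have T: "norm T = norm (S ** S)" "norm (S ** S ** U) = norm (S ** S)"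
    using p unitary_norm_left[of U "S ** S"] unitary_norm_right[of U "S ** S"]
    by (simp_all add: matrix_mul_assoc)
  have "(norm (aluthge T))\<^sup>2 = (S ** (U ** S)) \<bullet> (S ** U ** S)"
    by (simp add: aluthge_polar[OF assms] power2_norm_eq_inner matrix_mul_assoc)
  also have "\<dots> = (U ** S) \<bullet> (S ** S ** U ** S)"
    by (subst inner_mat_mult_left) (simp add: p matrix_mul_assoc)
  also have "\<dots> = (S ** S ** U) \<bullet> (U ** S ** S)"
    by (subst inner_commute, subst inner_mat_mult_right) (simp add: p)
  finally have *: "(norm (aluthge T))\<^sup>2 = (S ** S ** U) \<bullet> T" by (simp add: p(4))
  have "(norm (S ** S ** U - T))\<^sup>2 = (norm (S ** S ** U))\<^sup>2 + (norm T)\<^sup>2 - 2 * ((S ** S ** U) \<bullet> T)"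
    by (simp add: power2_norm_eq_inner inner_diff_left inner_diff_right inner_commute)
  then have "(norm (S ** S ** U - T))\<^sup>2 = 2 * (norm T)\<^sup>2 - 2 * (norm (aluthge T))\<^sup>2"
    using * T by simp
  then show ?thesis unfolding p(4)[symmetric] by linarith
qed

lemma norm_aluthge_le: "invertible T \<Longrightarrow> norm (aluthge T) \<le> norm T"
proof -
  assume "invertible T"
  then obtain S U where "polar T S U" using polar_exists by blast
  from norm_aluthge[OF this] have "(norm (aluthge T))\<^sup>2 \<le> (norm T)\<^sup>2" by simp
  then show ?thesis by (rule power2_le_imp_le) simp
qed

text \<open>The same computation for the inverses, finished by Cauchy-Schwarz. It keeps orbits away
  from the singular matrices, so that limit points are invertible.\<close>

lemma norm_inv_aluthge_le:
  assumes "invertible T" shows "norm (matrix_inv (aluthge T)) \<le> norm (matrix_inv T)"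
proof -
  obtain S U where SU: "polar T S U" using polar_exists assms by blast
  define P where "P = matrix_inv S"
  have PH: "P\<^sup>H = P" using polar_inv_adjoint[OF SU] P_def by simp
  have U: "unitary_mat (U\<^sup>H)" using polarD[OF SU] unitary_adjoint by blast
  have i: "matrix_inv (aluthge T) = P ** U\<^sup>H ** P" "matrix_inv T = P ** P ** U\<^sup>H"
    using aluthge_inverse[OF SU] by (simp_all add: P_def)
  have "(norm (P ** U\<^sup>H ** P))\<^sup>2 = (P ** (U\<^sup>H ** P)) \<bullet> (P ** U\<^sup>H ** P)"
    by (simp add: power2_norm_eq_inner matrix_mul_assoc)
  also have "\<dots> = (U\<^sup>H ** P) \<bullet> (P ** P ** U\<^sup>H ** P)"
    by (subst inner_mat_mult_left) (simp add: PH matrix_mul_assoc)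
  also have "\<dots> = (P ** P ** U\<^sup>H) \<bullet> (U\<^sup>H ** P ** P)"
    by (subst inner_commute, subst inner_mat_mult_right) (simp add: PH)
  also have "\<dots> \<le> norm (P ** P ** U\<^sup>H) * norm (U\<^sup>H ** P ** P)" by (rule norm_cauchy_schwarz)
  also have "\<dots> = (norm (matrix_inv T))\<^sup>2"
    using unitary_norm_left[OF U, of "P ** P"] unitary_norm_right[OF U, of "P ** P"]
    by (simp add: i power2_eq_square matrix_mul_assoc)
  finally show ?thesis unfolding i(1) by (rule power2_le_imp_le) simp
qed

text \<open>No loss of norm means that \<open>U\<close> commutes with \<open>S ** S\<close>, and
  then \<open>U\<close> cancels from \<open>T ** T\<^sup>H\<close>.\<close>

lemma aluthge_norm_eq_imp_normal:
  assumes "invertible T" "norm (aluthge T) = norm T"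
  shows "normal_mat T"
proof -
  obtain S U where SU: "polar T S U" using polar_exists assms by blast
  note p = polarD[OF SU]
  have comm: "U ** S ** S = S ** S ** U"
    using norm_aluthge[OF SU] assms(2) by simp
  have "T ** T\<^sup>H = (U ** S ** S) ** S ** S ** U\<^sup>H"
    by (simp add: p adjoint_mult matrix_mul_assoc)
  also have "\<dots> = S ** S ** U ** S ** S ** U\<^sup>H" by (simp only: comm)
  also have "\<dots> = S ** S ** (U ** S ** S) ** U\<^sup>H" by (simp only: matrix_mul_assoc)
  also have "\<dots> = S ** S ** (S ** S ** U) ** U\<^sup>H" by (simp only: comm)
  also have "\<dots> = T\<^sup>H ** T" by (simp add: mult_cancel_left p(7) polar_adjoint_mult[OF SU] matrix_mul_assoc)
  finally show ?thesis by (simp add: normal_mat_def)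
qed

section \<open>Continuity of the Aluthge transform on invertible matrices\<close>

lemma tendsto_if_unique_subseq_limit:
  fixes X :: "nat \<Rightarrow> 'a::heine_borel"
  assumes b: "bounded (range X)"
    and u: "\<And>r l. strict_mono r \<Longrightarrow> (X \<circ> r) \<longlonglongrightarrow> l \<Longrightarrow> l = L"
  shows "X \<longlonglongrightarrow> L"
proof (rule ccontr)
  assume "\<not> X \<longlonglongrightarrow> L"
  then obtain e where e: "e > 0" "\<exists>\<^sub>F n in sequentially. \<not> dist (X n) L < e"
    by (auto simp: tendsto_iff not_eventually)
  then have "infinite {n. \<not> dist (X n) L < e}"
    by (simp add: cofinite_eq_sequentially flip: frequently_cofinite)
  then obtain r :: "nat \<Rightarrow> nat" where r: "strict_mono r" "\<And>n. \<not> dist (X (r n)) L < e"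
    using infinite_enumerate by blast
  \<comment> \<open>The subsequence staying away from \<open>L\<close> is bounded, so it has a
    convergent subsequence, whose limit would have to be \<open>L\<close>.\<close>
  have "bounded (range (X \<circ> r))" using b by (rule bounded_subset) auto
  then obtain l s where s: "strict_mono s" "((X \<circ> r) \<circ> s) \<longlonglongrightarrow> l"
    using bounded_imp_convergent_subsequence by blast
  then have "l = L" using u[of "r \<circ> s" l] r by (simp add: o_assoc strict_mono_o)
  then have "\<forall>\<^sub>F n in sequentially. dist (X (r (s n))) L < e"
    using s e(1) by (simp add: tendsto_iff)
  then show False using r(2) by simp
qed

lemma psd_mat_limit:
  assumes "S \<longlonglongrightarrow> L" "\<And>n. psd_mat (S n)" shows "psd_mat L"
proof -
  have "(\<lambda>n. (S n)\<^sup>H) \<longlonglongrightarrow> L\<^sup>H" by (intro tendsto_adjoint assms)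
  then have "S \<longlonglongrightarrow> L\<^sup>H" using assms by (simp add: psd_adjoint)
  then have "L\<^sup>H = L" using assms(1) LIMSEQ_unique by blast
  moreover have "0 \<le> x \<bullet> (L *v x)" for x
  proof (rule LIMSEQ_le_const)
    show "(\<lambda>n. x \<bullet> (S n *v x)) \<longlonglongrightarrow> x \<bullet> (L *v x)"
      unfolding matrix_vector_mult_def by (intro tendsto_intros assms(1))
  qed (use assms in \<open>auto simp: psd_mat_iff\<close>)
  ultimately show ?thesis by (simp add: psd_mat_iff)
qed

text \<open>The squared norm of the Hermitian \<open>S\<close> is the inner product of the identity
  with \<open>S ** S\<close>, whose norm is that of \<open>T\<close>. The bounds serve a compactness
  argument.\<close>

lemma polar_bound:
  fixes T :: "complex^'n^'n"
  assumes "polar T S U"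
  shows "(norm S)\<^sup>2 \<le> norm (mat 1 :: complex^'n^'n) * norm T"
    and "norm U = norm (mat 1 :: complex^'n^'n)"
proof -
  note p = polarD[OF assms]
  have "(norm S)\<^sup>2 = mat 1 \<bullet> (S ** S)"
    using inner_mat_mult_left[of S "mat 1" S] by (simp add: power2_norm_eq_inner p)
  also have "\<dots> \<le> norm (mat 1 :: complex^'n^'n) * norm (S ** S)" by (rule norm_cauchy_schwarz)
  also have "norm (S ** S) = norm T"
    using unitary_norm_left[OF p(3), of "S ** S"] by (simp add: p matrix_mul_assoc)
  finally show "(norm S)\<^sup>2 \<le> norm (mat 1 :: complex^'n^'n) * norm T" .
  show "norm U = norm (mat 1 :: complex^'n^'n)"
    using unitary_norm_left[OF p(3), of "mat 1"] by simp
qed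

text \<open>The polar factors of a convergent sequence are bounded, and every subsequential limit of
  them is a polar factorisation of the limit \<open>T\<close>. Uniqueness of the factors makes the
  whole sequence of factors converge.\<close>

lemma continuous_on_aluthge:
  "continuous_on {T :: complex^'n^'n. invertible T} aluthge"
  unfolding continuous_on_sequentially
proof (intro allI ballI impI, elim conjE)
  fix X :: "nat \<Rightarrow> complex^'n^'n" and T
  assume "T \<in> {T. invertible T}" and X: "\<forall>n. X n \<in> {T. invertible T}" "X \<longlonglongrightarrow> T"
  then obtain S0 U0 where T: "polar T S0 U0" using polar_exists by blast
  from X have "\<forall>n. \<exists>S U. polar (X n) S U" using polar_exists by blast
  then obtain S U where SU: "\<And>n. polar (X n) (S n) (U n)" by metis
  obtain B where B: "\<And>n. norm (X n) \<le> B"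
    using convergent_imp_bounded[OF X(2)] by (auto simp: bounded_iff)
  define N where "N = norm (mat 1 :: complex^'n^'n)"
  have "norm (S n) \<le> sqrt (N * B)" for n
  proof (rule real_le_rsqrt)
    have "(norm (S n))\<^sup>2 \<le> N * norm (X n)" unfolding N_def by (rule polar_bound[OF SU])
    also have "\<dots> \<le> N * B" by (intro mult_left_mono B) (simp add: N_def)
    finally show "(norm (S n))\<^sup>2 \<le> N * B" .
  qed
  then have "norm (S n, U n) \<le> sqrt (N * B) + N" for n
    using norm_Pair_le[of "S n" "U n"] polar_bound(2)[OF SU, of n] unfolding N_def[symmetric]
    by (metis add_right_mono order_trans)
  then have bd: "bounded (range (\<lambda>n. (S n, U n)))"
    unfolding bounded_iff by blast
  have lim: "(\<lambda>n. (S n, U n)) \<longlonglongrightarrow> (S0, U0)"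
  proof (rule tendsto_if_unique_subseq_limit[OF bd])
    fix r l assume r: "strict_mono (r :: nat \<Rightarrow> nat)" and rl: "((\<lambda>n. (S n, U n)) \<circ> r) \<longlonglongrightarrow> l"
    have l: "(\<lambda>n. S (r n)) \<longlonglongrightarrow> fst l" "(\<lambda>n. U (r n)) \<longlonglongrightarrow> snd l"
      using tendsto_fst[OF rl] tendsto_snd[OF rl] by (simp_all add: o_def)
    have "psd_mat (fst l)" using psd_mat_limit[OF l(1)] polarD(1)[OF SU] by blast
    moreover have "unitary_mat (snd l)"
    proof -
      have "(\<lambda>n. (U (r n))\<^sup>H ** U (r n)) \<longlonglongrightarrow> (snd l)\<^sup>H ** snd l"
        by (intro mm.tendsto tendsto_adjoint l)
      then have "(snd l)\<^sup>H ** snd l = mat 1"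
        by (simp add: polarD(6)[OF SU] LIMSEQ_const_iff)
      then show ?thesis by (simp add: unitary_mat_def mat_inv_commute)
    qed
    moreover have TT: "T = snd l ** fst l ** fst l"
    proof -
      have "(\<lambda>n. U (r n) ** S (r n) ** S (r n)) \<longlonglongrightarrow> snd l ** fst l ** fst l"
        by (intro mm.tendsto l)
      then have "(X \<circ> r) \<longlonglongrightarrow> snd l ** fst l ** fst l" by (simp add: o_def flip: polarD(4)[OF SU])
      moreover have "(X \<circ> r) \<longlonglongrightarrow> T" using X(2) r by (rule LIMSEQ_subseq_LIMSEQ)
      ultimately show ?thesis using LIMSEQ_unique by blast
    qed
    moreover have "invertible (fst l)"
    proof -
      have "matrix_inv T ** snd l ** fst l ** fst l = mat 1"
        using TT matrix_inv_mult(2)[OF polar_invertible[OF T]] by (simp add: matrix_mul_assoc)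
      then show ?thesis using mat_inv_commute invertible_def by blast
    qed
    ultimately have "polar T (fst l) (snd l)" by (simp add: polar_def)
    then show "l = (S0, U0)" using polar_unique[OF T] by (simp add: prod_eq_iff)
  qed
  have "S \<longlonglongrightarrow> S0" "U \<longlonglongrightarrow> U0"
    using tendsto_fst[OF lim] tendsto_snd[OF lim] by simp_all
  then have "(\<lambda>n. S n ** U n ** S n) \<longlonglongrightarrow> S0 ** U0 ** S0" by (intro mm.tendsto)
  then show "(aluthge \<circ> X) \<longlonglongrightarrow> aluthge T"
    by (simp add: o_def aluthge_polar[OF SU] aluthge_polar[OF T])
qed

subsection \<open>Matrices commuting with \<open>T\<close> along the Aluthge iteration\<close>

lemma norm_add_sq: "(norm (a + b))\<^sup>2 + (norm (a - b))\<^sup>2 = 2 * (norm a)\<^sup>2 + 2 * (norm b)\<^sup>2"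
  for a b :: "'a::real_inner"
  by (simp add: power2_norm_eq_inner inner_add_left inner_add_right inner_diff_left inner_diff_right
      inner_commute)

lemma norm_add_sq_diff: "(norm (a + b))\<^sup>2 = (norm (a - b))\<^sup>2 + 4 * (a \<bullet> b)"
  for a b :: "'a::real_inner"
  by (simp add: power2_norm_eq_inner inner_add_left inner_add_right inner_diff_left inner_diff_right
      inner_commute)

text \<open>For an idempotent \<open>E\<close> this measures the distance from being an orthogonal
  projection; it is zero exactly when \<open>E\<close> is Hermitian.\<close>

definition skew :: "complex^'n^'n \<Rightarrow> complex^'n^'n" where
  "skew E = E - E\<^sup>H"

lemma polar_commute:
  assumes SU: "polar T S U" and ET: "E ** T = T ** E"
  shows "U\<^sup>H ** E ** U ** S ** S = S ** S ** E"
    and "S ** S ** U\<^sup>H ** E\<^sup>H ** U = E\<^sup>H ** S ** S"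
proof -
  note p = polarD[OF SU]
  have "U\<^sup>H ** E ** U ** S ** S = U\<^sup>H ** (E ** T)" by (simp add: p(4) matrix_mul_assoc)
  also have "\<dots> = U\<^sup>H ** U ** S ** S ** E" unfolding ET by (simp add: p(4) matrix_mul_assoc)
  finally show 1: "U\<^sup>H ** E ** U ** S ** S = S ** S ** E" by (simp add: p(6))
  have "(S ** S ** E)\<^sup>H = (U\<^sup>H ** E ** U ** S ** S)\<^sup>H" by (simp only: 1)
  then show "S ** S ** U\<^sup>H ** E\<^sup>H ** U = E\<^sup>H ** S ** S"
    by (simp add: adjoint_mult p(5) matrix_mul_assoc)
qed

text \<open>From \<open>a ** H = H ** b\<close> follow two forms of \<open>skew E'\<close>, namely
  \<open>P ** a ** S\<close> and \<open>S ** b ** P\<close>, and pairing them leaves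
  \<open>a \<bullet> b\<close>. Since \<open>a + b = F + J\<close> and \<open>J\<close> has the norm
  of \<open>F\<close>, the parallelogram law and polarisation give the identity, with
  \<open>y\<close> the norm of \<open>a - b\<close>. The commutator with \<open>T\<close> splits
  into those with \<open>U\<close> and with \<open>H\<close>.\<close>

lemma skew_step:
  assumes SU: "polar T S U" and ET: "E ** T = T ** E"
  defines "E' \<equiv> S ** E ** matrix_inv S"
  defines "x \<equiv> norm (skew E - U\<^sup>H ** skew E ** U)"
  obtains y where "4 * (norm (skew E'))\<^sup>2 = 4 * (norm (skew E))\<^sup>2 - x\<^sup>2 - y\<^sup>2"
    and "norm (T ** skew E - skew E ** T) \<le> norm T * (2 * x + y)" and "y \<ge> 0"
proof -
  note p = polarD[OF SU]
  define P where "P = matrix_inv S"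
  have PH: "P\<^sup>H = P" using polar_inv_adjoint[OF SU] P_def by simp
  have PS: "P ** S = mat 1" "S ** P = mat 1" using p by (simp_all add: P_def)
  define H where "H = S ** S"
  define F where "F = skew E"
  define J where "J = U\<^sup>H ** F ** U"
  define a where "a = U\<^sup>H ** E ** U - E\<^sup>H"
  define b where "b = E - U\<^sup>H ** E\<^sup>H ** U"
  have aH: "a ** S ** S = S ** S ** E - E\<^sup>H ** S ** S"
    by (simp add: a_def mat_distrib polar_commute[OF SU ET])
  have Hb: "S ** S ** b = S ** S ** E - E\<^sup>H ** S ** S"
    by (simp add: b_def mat_distrib polar_commute[OF SU ET])
  have ab: "a ** H = H ** b" using aH Hb by (simp add: H_def matrix_mul_assoc)
  have abF: "a + b = F + J"
    by (simp add: a_def b_def F_def J_def skew_def mat_distrib)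
  have sk: "skew E' = S ** E ** P - P ** E\<^sup>H ** S"
    by (simp add: skew_def E'_def adjoint_mult p(5) PH matrix_mul_assoc flip: P_def)
  have 1: "skew E' = P ** (a ** S)"
  proof -
    have "P ** a ** S = P ** (a ** S ** S) ** P"
      by (simp add: matrix_mul_assoc mult_cancel_left[OF PS(2)])
    also have "\<dots> = skew E'"
      unfolding aH sk
      by (simp add: mat_distrib mult_cancel_left[OF PS(2)] PS)
    finally show ?thesis by (simp add: matrix_mul_assoc)
  qed
  have 2: "skew E' = S ** b ** P"
  proof -
    have "S ** b ** P = P ** (S ** S ** b) ** P"
      by (simp add: matrix_mul_assoc PS)
    also have "\<dots> = skew E'"
      unfolding Hb sk
      by (simp add: mat_distrib mult_cancel_left[OF PS(2)] PS)
    finally show ?thesis by simp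
  qed
  have "(norm (skew E'))\<^sup>2 = (P ** (a ** S)) \<bullet> (S ** b ** P)"
    using 1 2 by (simp add: power2_norm_eq_inner)
  also have "\<dots> = a \<bullet> b"
    by (subst inner_mat_mult_left, subst inner_mat_mult_right)
      (simp add: PH p(5) matrix_mul_assoc mult_cancel_left[OF PS(1)] PS)
  finally have nab: "(norm (skew E'))\<^sup>2 = a \<bullet> b" .
  have nJ: "norm J = norm F"
    using unitary_norm_left[OF unitary_adjoint[OF p(3)], of "F ** U"] unitary_norm_right[OF p(3), of F]
    by (simp add: J_def matrix_mul_assoc)
  define y where "y = norm (a - b)"
  have x: "x = norm (F - J)" by (simp add: x_def F_def J_def)
  have "4 * (norm (skew E'))\<^sup>2 = 4 * (norm F)\<^sup>2 - x\<^sup>2 - y\<^sup>2"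
    using norm_add_sq[of F J] norm_add_sq_diff[of a b] nJ
    by (simp add: nab abF x y_def)
  moreover have "norm (T ** F - F ** T) \<le> norm T * (2 * x + y)"
  proof -
    have TU: "T = U ** H" by (simp add: H_def p(4) matrix_mul_assoc)
    have nH: "norm H = norm T" by (simp add: TU unitary_norm_left[OF p(3)])
    have bound: "norm (H ** X) \<le> norm T * norm X" "norm (X ** H) \<le> norm T * norm X" for X
      using norm_mat_mult_le[of H X] norm_mat_mult_le[of X H] by (simp_all add: nH mult.commute)
    have "U ** F - F ** U = U ** (F - J)"
      using p(7) by (simp add: J_def mat_distrib)
    then have nU: "norm (U ** F - F ** U) = x" by (simp add: unitary_norm_left[OF p(3)] x)
    \<comment> \<open>Doubling brings in \<open>a + b\<close>, whose commutator with
      \<open>H\<close> is expressed through \<open>a - b\<close> because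
      \<open>a ** H = H ** b\<close>. This bounds the commutator of \<open>F\<close> with
      \<open>H\<close> by \<open>x\<close> and \<open>y\<close>.\<close>
    have "F + F = (a + b) + (F - J)" unfolding abF by simp
    then have "(F ** H + F ** H) - (H ** F + H ** F) =
       ((a + b) ** H - H ** (a + b)) + ((F - J) ** H - H ** (F - J))"
      by (metis (no_types, lifting) add_diff_add mm.add_left mm.add_right)
    moreover have "(a + b) ** H - H ** (a + b) = - ((a - b) ** H + H ** (a - b))"
      using ab by (simp add: mm.add_left mm.add_right mm.diff_left mm.diff_right)
    ultimately have "2 *\<^sub>R (H ** F - F ** H) = ((a - b) ** H + H ** (a - b)) - ((F - J) ** H - H ** (F - J))"
      by (simp add: scaleR_2 algebra_simps)
    then have "norm (2 *\<^sub>R (H ** F - F ** H)) \<le> norm ((a - b) ** H) + norm (H ** (a - b))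
      + (norm ((F - J) ** H) + norm (H ** (F - J)))"
      by (simp only: order_trans[OF norm_triangle_ineq4 add_mono[OF norm_triangle_ineq norm_triangle_ineq4]])
    also have "\<dots> \<le> (norm T * y + norm T * y) + (norm T * x + norm T * x)"
      unfolding y_def x by (intro add_mono bound)
    finally have nHF: "norm (H ** F - F ** H) \<le> norm T * y + norm T * x"
      by (simp add: mult.commute)
    have "T ** F - F ** T = U ** (H ** F - F ** H) + (U ** F - F ** U) ** H"
      by (simp add: TU mat_distrib)
    then have "norm (T ** F - F ** T) \<le> norm (U ** (H ** F - F ** H)) + norm ((U ** F - F ** U) ** H)"
      by (simp only: norm_triangle_ineq)
    also have "\<dots> \<le> (norm T * y + norm T * x) + norm T * x"
      using bound(2)[of "U ** F - F ** U"] nU nHF unitary_norm_left[OF p(3)] by (intro add_mono) simp_all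
    finally show ?thesis by (simp add: algebra_simps)
  qed
  ultimately show ?thesis using that[of y] by (simp add: y_def F_def)
qed

text \<open>With \<open>K\<close> the positive root of \<open>S\<close> and \<open>M\<close> its
  inverse, the inner product is the square of the norm of \<open>K ** X ** M\<close>: conjugation by
  a positive matrix is a positive operator.\<close>

lemma inner_conj_nonneg:
  fixes S X :: "complex^'n^'n"
  assumes S: "psd_mat S" "invertible S"
  shows "0 \<le> X \<bullet> (S ** X ** matrix_inv S)"
proof -
  obtain K where K: "psd_mat K" "K ** K = S" using psd_sqrt_exists S by blast
  have "matrix_inv S ** K ** K = mat 1"
    using K matrix_inv_mult[OF S(2)] by (simp flip: matrix_mul_assoc)
  then have iK: "invertible K" using mat_inv_commute invertible_def by blast
  define M where "M = matrix_inv K"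
  have KM: "K ** M = mat 1" "M ** K = mat 1" using matrix_inv_mult[OF iK] by (simp_all add: M_def)
  have MH: "M\<^sup>H = M"
    by (metis KM(2) K(1) M_def adjoint_mult adjoint_one matrix_inv_eqI(2) psd_adjoint)
  have "matrix_inv S = M ** M"
    by (rule matrix_inv_eqI(2)) (simp add: K(2)[symmetric] matrix_mul_assoc mult_cancel_left[OF KM(1)] KM)
  then have "X \<bullet> (S ** X ** matrix_inv S) = (K ** (X ** M)) \<bullet> (K ** (X ** M))"
    by (subst inner_mat_mult_left, subst inner_mat_mult_right)
      (simp add: matrix_mul_assoc MH psd_adjoint[OF K(1)] K(2)[symmetric])
  then show ?thesis by simp
qed

lemma norm_le_conj_add:
  fixes S X :: "complex^'n^'n"
  assumes S: "psd_mat S" "invertible S"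
  shows "norm X \<le> norm (S ** X ** matrix_inv S + X)"
proof -
  have "norm X * norm X \<le> X \<bullet> (S ** X ** matrix_inv S + X)"
    using inner_conj_nonneg[OF S, of X]
    by (simp add: inner_add_right flip: power2_eq_square power2_norm_eq_inner)
  also have "\<dots> \<le> norm X * norm (S ** X ** matrix_inv S + X)" by (rule norm_cauchy_schwarz)
  finally show ?thesis by (cases "norm X = 0") auto
qed

text \<open>Identity plus conjugation by a positive matrix does not shrink norms. Applying this with
  \<open>S\<close> to the step \<open>X\<close> gives \<open>v\<close>, and with \<open>H\<close> to
  \<open>v\<close> gives an expression in which \<open>E\<close> enters only through
  \<open>skew E\<close>.\<close>

lemma commuting_step_le:
  assumes SU: "polar T S U" and ET: "E ** T = T ** E"
  shows "norm (S ** E ** matrix_inv S - E) \<le> (1 + norm T * norm (matrix_inv T)) * norm (skew E)"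
proof -
  note p = polarD[OF SU]
  define P where "P = matrix_inv S"
  have PS: "P ** S = mat 1" "S ** P = mat 1" using p by (simp_all add: P_def)
  define H where "H = S ** S"
  have iH: "matrix_inv H = P ** P" "invertible H"
    using matrix_inv_eqI[of H "P ** P"] by (simp_all add: H_def matrix_mul_assoc mult_cancel_left[OF PS(2)] PS)
  have psdH: "psd_mat H" by (simp add: H_def psd_square p)
  note c = polar_commute[OF SU ET]
  define X where "X = S ** E ** P - E"
  define v where "v = U\<^sup>H ** E ** U - E"
  have cP: "U\<^sup>H ** E ** U = S ** S ** E ** P ** P"
    by (simp add: mult_cancel_left[OF PS(2)] flip: c(1))
  have "S ** X ** P + X = v"
    by (simp add: X_def v_def cP mat_distrib)
  then have "norm X \<le> norm v"
    using norm_le_conj_add[OF p(1,2), of X] by (simp flip: P_def)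
  also have "norm v \<le> norm (H ** v ** matrix_inv H + v)"
    by (rule norm_le_conj_add[OF psdH iH(2)])
  also have "H ** v ** matrix_inv H + v = H ** (U\<^sup>H ** skew E ** U) ** matrix_inv H - skew E"
    unfolding iH by (simp add: H_def v_def skew_def mat_distrib c(2) cP mult_cancel_left[OF PS(2)])
  also have "norm \<dots> \<le> norm H * norm (U\<^sup>H ** skew E ** U) * norm (matrix_inv H) + norm (skew E)"
    by (rule norm_triangle_le_diff)
      (meson add_right_mono norm_mat_mult_le mult_right_mono norm_ge_zero order_trans)
  also have "norm (U\<^sup>H ** skew E ** U) = norm (skew E)"
    using unitary_norm_left[OF unitary_adjoint[OF p(3)], of "skew E ** U"] unitary_norm_right[OF p(3), of "skew E"]
    by (simp add: matrix_mul_assoc)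
  also have "norm H = norm T"
    using unitary_norm_left[OF p(3), of H] by (simp add: H_def p matrix_mul_assoc)
  also have "norm (matrix_inv H) = norm (matrix_inv T)"
    using aluthge_inverse(3)[OF SU] unitary_norm_right[OF unitary_adjoint[OF p(3)], of "P ** P"]
    by (simp add: iH flip: P_def)
  finally show ?thesis by (simp add: X_def P_def algebra_simps)
qed

text \<open>\<open>F\<close> is cut into four blocks by \<open>E\<close> and \<open>G\<close>. For
  an idempotent the diagonal blocks are quadratic in \<open>F\<close>, since
  \<open>E ** F ** E = E ** F ** F\<close>; the off-diagonal blocks are compressions of the
  commutator with \<open>E\<close>. So a small \<open>F\<close> is controlled by that
  commutator.\<close>

lemma skew_idempotent_le:
  fixes E :: "complex^'n^'n"
  assumes E: "E ** E = E"
  defines "F \<equiv> skew E" and "G \<equiv> mat 1 - E"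
  shows "norm F \<le> (norm E + norm G) * (norm F)\<^sup>2 + 2 * norm G * norm (E ** F - F ** E)"
proof -
  have idem: "A ** skew A ** A = A ** skew A ** skew A" if A: "A ** A = A" for A :: "complex^'n^'n"
  proof -
    have "A\<^sup>H ** A\<^sup>H = A\<^sup>H" using A by (metis adjoint_mult)
    then have *: "X ** A\<^sup>H ** A\<^sup>H = X ** A\<^sup>H" "X ** A ** A = X ** A" for X
      using A by (simp_all flip: matrix_mul_assoc)
    show ?thesis by (simp add: skew_def mat_distrib * A)
  qed
  have GG: "G ** G = G" by (simp add: G_def mat_distrib E)
  have skG: "skew G = - F" by (simp add: G_def F_def skew_def adjoint_diff)
  have 1: "E ** F ** E = E ** F ** F" using idem[OF E] by (simp add: F_def)
  have "- (G ** F ** G) = G ** F ** F" using idem[OF GG] by (simp add: skG mat_distrib)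
  then have 2: "G ** F ** G = - (G ** F ** F)" by (metis minus_minus)
  have EG: "E ** G = 0" "G ** E = 0" by (simp_all add: G_def mat_distrib E)
  have 3: "E ** F ** G = (E ** F - F ** E) ** G"
    using EG by (simp add: mm.diff_left flip: matrix_mul_assoc)
  have 4: "G ** F ** E = - (G ** (E ** F - F ** E))"
    using EG by (simp add: mm.diff_right matrix_mul_assoc)
  have "F = E ** F ** E + G ** F ** G + E ** F ** G + G ** F ** E"
    by (simp add: G_def mat_distrib)
  also have "\<dots> = E ** F ** F - G ** F ** F + (E ** F - F ** E) ** G - G ** (E ** F - F ** E)"
    unfolding 1 2 3 4 by simp
  finally have "norm F \<le> norm (E ** F ** F) + norm (G ** F ** F) + norm ((E ** F - F ** E) ** G)
      + norm (G ** (E ** F - F ** E))"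
    by (metis (no_types) order_trans[OF norm_triangle_ineq4 add_right_mono[OF order_trans[OF
        norm_triangle_ineq add_right_mono[OF norm_triangle_ineq4]]]])
  also have "\<dots> \<le> norm E * norm F * norm F + norm G * norm F * norm F + norm (E ** F - F ** E) * norm G
      + norm G * norm (E ** F - F ** E)"
    by (intro add_mono) (meson norm_mat_mult_le mult_right_mono norm_ge_zero order_trans)+
  finally show ?thesis by (simp add: algebra_simps power2_eq_square)
qed

lemma matpoly_bounded:
  fixes p :: "complex poly"
  shows "\<exists>M\<ge>0. \<forall>T :: complex^'n^'n. norm T \<le> B \<longrightarrow> norm (matpoly p T) \<le> M"
proof -
  have "compact ((matpoly p :: complex^'n^'n \<Rightarrow> _) ` cball 0 B)"
    by (intro compact_continuous_image continuous_on_matpoly) auto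
  then have "bounded ((matpoly p :: complex^'n^'n \<Rightarrow> _) ` cball 0 B)" by (rule compact_imp_bounded)
  then obtain M where "\<forall>T \<in> cball (0 :: complex^'n^'n) B. norm (matpoly p T) \<le> M"
    unfolding bounded_iff by blast
  then show ?thesis by (intro exI[of _ "max M 0"]) (auto simp: max.coboundedI1)
qed

text \<open>Horner's scheme and the product rule for commutators: the commutator of
  \<open>T ** q\<close> is \<open>T\<close> times that of \<open>q\<close> plus that of
  \<open>T\<close> times \<open>q\<close>.\<close>

lemma matpoly_commutator_le:
  fixes p :: "complex poly"
  shows "\<exists>L\<ge>0. \<forall>T F :: complex^'n^'n. norm T \<le> B \<longrightarrow>
    norm (matpoly p T ** F - F ** matpoly p T) \<le> L * norm (T ** F - F ** T)"
proof (induction p)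
  case (pCons a p)
  then obtain L where L: "L \<ge> 0" "\<And>T F :: complex^'n^'n. norm T \<le> B \<Longrightarrow>
    norm (matpoly p T ** F - F ** matpoly p T) \<le> L * norm (T ** F - F ** T)" by blast
  obtain M where M: "M \<ge> 0" "\<And>T :: complex^'n^'n. norm T \<le> B \<Longrightarrow> norm (matpoly p T) \<le> M"
    using matpoly_bounded by blast
  show ?case
  proof (rule exI[of _ "\<bar>B\<bar> * L + M"], intro conjI allI impI)
    fix T F :: "complex^'n^'n" assume T: "norm T \<le> B"
    let ?q = "matpoly p T" and ?c = "norm (T ** F - F ** T)"
    have "matpoly (pCons a p) T ** F - F ** matpoly (pCons a p) T
      = T ** (?q ** F - F ** ?q) + (T ** F - F ** T) ** ?q"
      by (simp add: mat_distrib mat_scalar_commute[of a F])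
    then have "norm (matpoly (pCons a p) T ** F - F ** matpoly (pCons a p) T)
      \<le> norm T * norm (?q ** F - F ** ?q) + ?c * norm ?q"
      by (metis norm_triangle_le add_mono norm_mat_mult_le)
    also have "\<dots> \<le> \<bar>B\<bar> * (L * ?c) + ?c * M"
      using T L M by (intro add_mono mult_mono) auto
    finally show "norm (matpoly (pCons a p) T ** F - F ** matpoly (pCons a p) T) \<le> (\<bar>B\<bar> * L + M) * ?c"
      by (simp add: algebra_simps)
  qed (use L M in auto)
qed (auto intro!: exI[of _ 0])

text \<open>The commutator of \<open>F\<close> with \<open>T\<close> bounds the one with
  \<open>matpoly p T\<close>, hence up to small errors the one with \<open>E\<close>, hence
  \<open>F\<close> itself. So \<open>f\<close> is at most a multiple of \<open>2 * x + y\<close>,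
  while \<open>x\<close> and \<open>y\<close> are what \<open>skew_step\<close> subtracts: a fixed
  fraction of \<open>f\<^sup>2\<close> is lost.\<close>

lemma skew_contraction:
  fixes B :: real
  obtains \<eta> \<rho> where "\<eta> > 0" "0 \<le> \<rho>" "\<rho> < 1"
    "\<And>T S U E :: complex^'n^'n. polar T S U \<Longrightarrow> E ** T = T ** E \<Longrightarrow> E ** E = E \<Longrightarrow> norm T \<le> B \<Longrightarrow>
       norm E \<le> B \<Longrightarrow> norm (E - matpoly p T) \<le> \<eta> \<Longrightarrow> norm (skew E) \<le> \<eta> \<Longrightarrow>
       norm (skew (S ** E ** matrix_inv S)) \<le> \<rho> * norm (skew E)"
proof -
  obtain L where L: "L \<ge> 0" "\<And>T F :: complex^'n^'n. norm T \<le> B \<Longrightarrow>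
    norm (matpoly p T ** F - F ** matpoly p T) \<le> L * norm (T ** F - F ** T)"
    using matpoly_commutator_le by blast
  define g where "g = norm (mat 1 :: complex^'n^'n) + \<bar>B\<bar>"
  have g: "g \<ge> 0" by (simp add: g_def)
  \<comment> \<open>Chosen so that the terms proportional to \<open>\<eta> * f\<close> add up to at
    most half of \<open>f\<close> and can be absorbed on the left.\<close>
  define \<eta> where "\<eta> = 1 / (2 * (\<bar>B\<bar> + 5 * g + 1))"
  have den: "\<bar>B\<bar> + 5 * g + 1 > 0" using g by simp
  then have eta: "\<eta> > 0" by (simp add: \<eta>_def)
  have eta2: "(\<bar>B\<bar> + 5 * g) * \<eta> \<le> 1 / 2" using g den by (simp add: \<eta>_def divide_simps)
  define C where "C = 4 * g * L * \<bar>B\<bar> + 1"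
  have C: "C \<ge> 1" using g L by (simp add: C_def)
  \<comment> \<open>The estimate below gives \<open>f\<^sup>2\<close> at most
    \<open>20 * C\<^sup>2\<close> times the loss: 5 from Cauchy-Schwarz for
    \<open>2 * x + y\<close>, 4 from the identity of \<open>skew_step\<close>. The summand 1 in
    \<open>C\<close> makes the radicand nonnegative.\<close>
  define \<rho> where "\<rho> = sqrt (1 - 1 / (20 * C\<^sup>2))"
  have C2: "1 / (20 * C\<^sup>2) > 0" "1 / (20 * C\<^sup>2) \<le> 1"
  proof -
    have "1 \<le> 20 * C\<^sup>2" using one_le_power[OF C, of 2] by linarith
    then show "1 / (20 * C\<^sup>2) > 0" "1 / (20 * C\<^sup>2) \<le> 1" using C by simp_all
  qed
  show ?thesis
  proof (rule that[OF eta])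
    show "0 \<le> \<rho>" "\<rho> < 1" using C2 by (simp_all add: \<rho>_def real_sqrt_lt_1_iff)
    fix T S U E :: "complex^'n^'n"
    assume SU: "polar T S U" and ET: "E ** T = T ** E" and EE: "E ** E = E" and T: "norm T \<le> B"
      and E: "norm E \<le> B" and Ep: "norm (E - matpoly p T) \<le> \<eta>" and sk: "norm (skew E) \<le> \<eta>"
    define F where "F = skew E"
    define f where "f = norm F"
    define G where "G = mat 1 - E"
    have G: "norm G \<le> g" using norm_triangle_ineq4[of "mat 1" E] E by (simp add: G_def g_def)
    obtain x y where y: "4 * (norm (skew (S ** E ** matrix_inv S)))\<^sup>2 = 4 * f\<^sup>2 - x\<^sup>2 - y\<^sup>2"
      "norm (T ** F - F ** T) \<le> norm T * (2 * x + y)" "y \<ge> 0" "x \<ge> 0"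
      using skew_step[OF SU ET] unfolding F_def f_def by (metis norm_ge_zero)
    define t where "t = norm (T ** F - F ** T)"
    have t: "t \<le> \<bar>B\<bar> * (2 * x + y)"
      using y T unfolding t_def by (smt (verit) mult_right_mono)
    have "E ** F - F ** E = ((E - matpoly p T) ** F - F ** (E - matpoly p T))
        + (matpoly p T ** F - F ** matpoly p T)"
      by (simp add: mat_distrib)
    then have "norm (E ** F - F ** E) \<le> norm ((E - matpoly p T) ** F) + norm (F ** (E - matpoly p T))
        + norm (matpoly p T ** F - F ** matpoly p T)"
      by (simp only: order_trans[OF norm_triangle_ineq add_right_mono[OF norm_triangle_ineq4]])
    also have "\<dots> \<le> \<eta> * f + f * \<eta> + L * t"
    proof (intro add_mono)
      show "norm ((E - matpoly p T) ** F) \<le> \<eta> * f"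
        using norm_mat_mult_le[of "E - matpoly p T" F] mult_right_mono[OF Ep, of f]
        by (simp add: f_def)
      show "norm (F ** (E - matpoly p T)) \<le> f * \<eta>"
        using norm_mat_mult_le[of F "E - matpoly p T"] mult_left_mono[OF Ep, of f]
        by (simp add: f_def)
    qed (use L T in \<open>simp add: t_def\<close>)
    finally have c: "norm (E ** F - F ** E) \<le> 2 * \<eta> * f + L * t" by simp
    have "f \<le> (norm E + norm G) * f\<^sup>2 + 2 * norm G * norm (E ** F - F ** E)"
      using skew_idempotent_le[OF EE] by (simp add: f_def F_def G_def)
    also have "\<dots> \<le> (\<bar>B\<bar> + g) * (\<eta> * f) + 2 * g * (2 * \<eta> * f + L * t)"
    proof (intro add_mono mult_mono c)
      show "f\<^sup>2 \<le> \<eta> * f" using sk by (simp add: power2_eq_square f_def F_def mult_right_mono)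
    qed (use G E g in \<open>auto simp: f_def\<close>)
    also have "\<dots> = ((\<bar>B\<bar> + 5 * g) * \<eta>) * f + 2 * g * L * t"
      by (simp add: algebra_simps)
    also have "\<dots> \<le> 1 / 2 * f + 2 * g * L * t"
      using eta2 by (intro add_right_mono mult_right_mono) (simp_all add: f_def)
    finally have "f \<le> 4 * g * L * t" by simp
    also have "\<dots> \<le> 4 * g * L * (\<bar>B\<bar> * (2 * x + y))"
      using t g L by (intro mult_left_mono) auto
    also have "\<dots> \<le> C * (2 * x + y)"
      using y by (simp add: C_def algebra_simps)
    finally have "f\<^sup>2 \<le> (C * (2 * x + y))\<^sup>2" by (intro power_mono) (simp_all add: f_def)
    also have "\<dots> \<le> C\<^sup>2 * (5 * (x\<^sup>2 + y\<^sup>2))"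
    proof -
      have "(2 * x + y)\<^sup>2 + (x - 2 * y)\<^sup>2 = 5 * (x\<^sup>2 + y\<^sup>2)" by (simp add: power2_eq_square algebra_simps)
      then have "(2 * x + y)\<^sup>2 \<le> 5 * (x\<^sup>2 + y\<^sup>2)" by (smt (verit) zero_le_power2)
      then show ?thesis by (simp add: power_mult_distrib mult_left_mono)
    qed
    also have "\<dots> = 20 * C\<^sup>2 * (f\<^sup>2 - (norm (skew (S ** E ** matrix_inv S)))\<^sup>2)"
    proof -
      have "x\<^sup>2 + y\<^sup>2 = 4 * (f\<^sup>2 - (norm (skew (S ** E ** matrix_inv S)))\<^sup>2)" using y(1) by simp
      then show ?thesis by simp
    qed
    finally have "f\<^sup>2 / (20 * C\<^sup>2) \<le> f\<^sup>2 - (norm (skew (S ** E ** matrix_inv S)))\<^sup>2"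
      using C by (simp add: divide_le_eq mult.commute)
    then have "(norm (skew (S ** E ** matrix_inv S)))\<^sup>2 \<le> (1 - 1 / (20 * C\<^sup>2)) * f\<^sup>2"
      by (simp add: algebra_simps)
    also have "\<dots> = (\<rho> * f)\<^sup>2" using C2 by (simp add: \<rho>_def power_mult_distrib)
    finally show "norm (skew (S ** E ** matrix_inv S)) \<le> \<rho> * norm (skew E)"
      using \<open>0 \<le> \<rho>\<close> by (metis F_def f_def mult_nonneg_nonneg norm_ge_zero power2_le_imp_le)
  qed
qed

subsection \<open>Idempotents by Newton iteration\<close>

text \<open>The polynomial 3 x^2 - 2 x^3, which is the Newton step for x^2 = x with the inverse of 2
  x - 1 replaced by 2 x - 1. Being a polynomial it respects commutation and similarity; multiples
  are written as sums so that only ring identities arise.\<close>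

definition newton :: "complex^'n^'n \<Rightarrow> complex^'n^'n" where
  "newton A = A ** A + A ** A + A ** A - (A ** A ** A + A ** A ** A)"

text \<open>The new defect is 4 e^3 - 3 e^2, so convergence is quadratic; only halving is used
  afterwards.\<close>

lemma newton_defect:
  fixes A :: "complex^'n^'n"
  defines "e \<equiv> A ** A - A"
  shows "newton A ** newton A - newton A =
    (e ** e ** e + e ** e ** e) + (e ** e ** e + e ** e ** e) - (e ** e + e ** e + e ** e)"
  unfolding newton_def e_def mat_distrib by (simp add: algebra_simps)

lemma newton_diff: "newton A - A = (A ** A - A) - (A ** (A ** A - A) + A ** (A ** A - A))"
  unfolding newton_def mat_distrib by (simp add: algebra_simps)

lemma newton_defect_le:
  fixes A :: "complex^'n^'n"
  assumes "norm (A ** A - A) \<le> 1/8"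
  shows "norm (newton A ** newton A - newton A) \<le> norm (A ** A - A) / 2"
proof -
  define e where "e = A ** A - A"
  define d where "d = norm e"
  have d: "0 \<le> d" "d \<le> 1/8" using assms by (simp_all add: d_def e_def)
  have 2: "norm (e ** e) \<le> d * d" using norm_mat_mult_le[of e e] by (simp add: d_def)
  have 3: "norm (e ** e ** e) \<le> d * d * d"
    using norm_mat_mult_le[of "e ** e" e] mult_right_mono[OF 2 d(1)] by (simp add: d_def)
  have "norm (newton A ** newton A - newton A) \<le> ((norm (e ** e ** e) + norm (e ** e ** e))
      + (norm (e ** e ** e) + norm (e ** e ** e))) + ((norm (e ** e) + norm (e ** e)) + norm (e ** e))"
    unfolding newton_defect e_def[symmetric]
    by (rule order_trans[OF norm_triangle_ineq4 add_mono])
      (rule order_trans[OF norm_triangle_ineq add_mono[OF norm_triangle_ineq norm_triangle_ineq]]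
        order_trans[OF norm_triangle_ineq add_right_mono[OF norm_triangle_ineq]])+
  also have "\<dots> \<le> 4 * (d * d * d) + 3 * (d * d)" using 2 3 by simp
  also have "\<dots> = (4 * d * d + 3 * d) * d" by (simp add: algebra_simps)
  also have "\<dots> \<le> (1/2) * d"
  proof (rule mult_right_mono[OF _ d(1)])
    have "d * d \<le> d * (1/8)" using d by (intro mult_left_mono) auto
    then show "4 * d * d + 3 * d \<le> 1/2" using d by simp
  qed
  finally show ?thesis by (simp add: d_def e_def)
qed

text \<open>The defect halves at each step, so the increments are at most \<open>q / 2 ^ k\<close>
  while the iterates have norm at most \<open>K\<close>. The total movement, at most
  \<open>2 * q\<close> and thus at most 1, keeps them there.\<close>

lemma newton_idempotent:
  fixes A :: "complex^'n^'n"
  assumes K: "norm A + 1 \<le> K" and d: "norm (A ** A - A) \<le> d" "d \<le> 1/8" "2 * (1 + 2 * K) * d \<le> 1"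
  obtains E where "(\<lambda>k. (newton ^^ k) A) \<longlonglongrightarrow> E" "E ** E = E" "norm (E - A) \<le> 2 * (1 + 2 * K) * d"
proof -
  define X where "X k = (newton ^^ k) A" for k
  define q where "q = (1 + 2 * K) * d"
  have K0: "K \<ge> 0" using K norm_ge_zero[of A] by linarith
  have d0: "d \<ge> 0" using d(1) norm_ge_zero order_trans by blast
  have q: "0 \<le> q" "2 * q \<le> 1" using d0 K0 d(3) unfolding q_def by (simp, simp only: mult.assoc)
  have X0: "X 0 = A" and XS: "\<And>k. X (Suc k) = newton (X k)" by (simp_all add: X_def)
  have e: "norm (X k ** X k - X k) \<le> d / 2 ^ k" for k
  proof (induction k)
    case (Suc k)
    have "d * 1 \<le> d * 2 ^ k" using d0 by (intro mult_left_mono) auto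
    then have "d / 2 ^ k \<le> d" by (simp add: divide_le_eq)
    then have "norm (X k ** X k - X k) \<le> 1/8" using Suc d by linarith
    from newton_defect_le[OF this]
    have "norm (X (Suc k) ** X (Suc k) - X (Suc k)) \<le> (d / 2 ^ k) / 2"
      unfolding XS by (rule order_trans) (use Suc in \<open>simp add: divide_right_mono\<close>)
    then show ?case by (simp add: mult.commute)
  qed (simp add: X0 d)
  have step: "norm (X (Suc k) - X k) \<le> q / 2 ^ k" if "norm (X k) \<le> K" for k
  proof -
    define D where "D = X k ** X k - X k"
    have D: "norm D \<le> d / 2 ^ k" using e by (simp add: D_def)
    have "norm (X k ** D) \<le> K * (d / 2 ^ k)"
      using norm_mat_mult_le[of "X k" D] mult_mono[OF that D] K0 by simp
    moreover have "norm (D - (X k ** D + X k ** D)) \<le> norm D + (norm (X k ** D) + norm (X k ** D))"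
      by (rule order_trans[OF norm_triangle_ineq4 add_left_mono[OF norm_triangle_ineq]])
    ultimately have "norm (D - (X k ** D + X k ** D)) \<le> d / 2 ^ k + (K * (d / 2 ^ k) + K * (d / 2 ^ k))"
      using D by linarith
    also have "\<dots> = q / 2 ^ k" by (simp add: q_def field_simps)
    finally show ?thesis by (simp add: XS newton_diff D_def)
  qed
  \<comment> \<open>The partial geometric sum, rather than its limit, makes the induction close; the
    margin 1 in \<open>K\<close> is what lets \<open>step\<close> apply at each stage.\<close>
  have near: "norm (X k - A) \<le> 2 * q * (1 - 1 / 2 ^ k)" for k
  proof (induction k)
    case (Suc k)
    have "2 * q * (1 - 1 / 2 ^ k) \<le> 1 * 1" using q by (intro mult_mono) auto
    then have "norm (X k - A) \<le> 1" using Suc by linarith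
    then have "norm (X k) \<le> K" using K norm_triangle_sub[of "X k" A] by linarith
    then have "norm (X (Suc k) - A) \<le> q / 2 ^ k + 2 * q * (1 - 1 / 2 ^ k)"
      using step[of k] Suc norm_triangle_ineq[of "X (Suc k) - X k" "X k - A"] by simp
    then show ?case by (simp add: field_simps)
  qed (simp add: X0)
  have near2: "norm (X k - A) \<le> 2 * q" for k
  proof -
    have "2 * q * (1 - 1 / 2 ^ k) \<le> 2 * q * 1" using q by (intro mult_left_mono) auto
    then show ?thesis using near[of k] by simp
  qed
  have "norm (X k) \<le> K" for k
    using near2[of k] q K norm_triangle_sub[of "X k" A] by linarith
  then have "norm (X (Suc k) - X k) \<le> q * (1/2) ^ k" for k
    using step by (simp add: power_divide)
  then have "summable (\<lambda>k. X (Suc k) - X k)"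
    by (rule summable_comparison_test'[where N = 0, rotated]) (simp add: summable_geometric)
  then have "convergent (\<lambda>n. \<Sum>k<n. X (Suc k) - X k)"
    by (simp add: summable_iff_convergent)
  then have "convergent (\<lambda>n. (X n - X 0) + X 0)"
    by (intro convergent_add convergent_const) (simp add: sum_lessThan_telescope)
  then obtain E where E: "X \<longlonglongrightarrow> E" by (auto simp: convergent_def)
  have "(\<lambda>k. X k ** X k - X k) \<longlonglongrightarrow> E ** E - E" by (intro tendsto_diff mm.tendsto E)
  moreover have "(\<lambda>k. X k ** X k - X k) \<longlonglongrightarrow> 0"
  proof (rule Lim_null_comparison)
    show "(\<lambda>k. d * (1/2) ^ k) \<longlonglongrightarrow> 0"
      by (intro tendsto_mult_right_zero LIMSEQ_power_zero) simp
  qed (use e in \<open>auto simp: power_divide\<close>)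
  ultimately have "E ** E = E" using LIMSEQ_unique by fastforce
  moreover have "norm (E - A) \<le> 2 * q"
    by (rule LIMSEQ_le_const2[of "\<lambda>k. norm (X k - A)"])
      (use near2 in \<open>auto intro!: tendsto_intros E\<close>)
  moreover have "(\<lambda>k. (newton ^^ k) A) \<longlonglongrightarrow> E" using E unfolding X_def .
  ultimately show ?thesis using that[of E] by (simp only: q_def mult.assoc)
qed

lemma newton_commute:
  assumes "A ** B = B ** A" shows "(newton ^^ k) A ** B = B ** (newton ^^ k) A"
proof (induction k)
  case (Suc k)
  define C where "C = (newton ^^ k) A"
  have c: "B ** C = C ** B" "X ** B ** C = X ** C ** B" for X
    using Suc by (simp_all add: C_def flip: matrix_mul_assoc)
  have "newton C ** B = B ** newton C" by (simp only: newton_def[of C] mat_distrib c)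
  then show ?case by (simp add: C_def)
qed (use assms in simp)

lemma newton_similar:
  fixes A G G' :: "complex^'n^'n"
  assumes "G' ** G = mat 1" shows "(newton ^^ k) (G ** A ** G') = G ** (newton ^^ k) A ** G'"
proof (induction k)
  case (Suc k)
  define C where "C = (newton ^^ k) A"
  have "newton (G ** C ** G') = G ** newton C ** G'"
    by (simp only: newton_def[of C] newton_def[of "G ** C ** G'"] mat_distrib mult_cancel_left[OF assms])
  then show ?case by (simp add: Suc C_def)
qed simp

subsection \<open>Limit points of Aluthge orbits\<close>

abbreviation orb :: "nat \<Rightarrow> complex^'n^'n \<Rightarrow> complex^'n^'n" where
  "orb n T \<equiv> (aluthge ^^ n) T"

lemma orb_invertible: "invertible T \<Longrightarrow> invertible (orb n T)"
proof (induction n)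
  case (Suc n)
  then obtain S U where "polar (orb n T) S U" using polar_exists by blast
  from aluthge_inverse(1)[OF this] show ?case by simp
qed simp

lemma norm_orb_mono: "invertible T \<Longrightarrow> m \<le> n \<Longrightarrow> norm (orb n T) \<le> norm (orb m T)"
proof -
  assume "invertible T" "m \<le> n"
  from this(2) show ?thesis
    by (induction rule: dec_induct)
      (auto intro: order_trans[OF norm_aluthge_le[OF orb_invertible[OF \<open>invertible T\<close>]]])
qed

lemma norm_orb_le: "invertible T \<Longrightarrow> norm (orb n T) \<le> norm T"
  using norm_orb_mono[of T 0 n] by simp

lemma norm_inv_orb_le: "invertible T \<Longrightarrow> norm (matrix_inv (orb n T)) \<le> norm (matrix_inv T)"
  by (induction n) (auto intro: order_trans[OF norm_inv_aluthge_le[OF orb_invertible]])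

lemma continuous_on_orb: "continuous_on {T :: complex^'n^'n. invertible T} (orb n)"
proof (induction n)
  case (Suc n)
  have "continuous_on {T :: complex^'n^'n. invertible T} (aluthge \<circ> orb n)"
    by (intro continuous_on_compose Suc continuous_on_subset[OF continuous_on_aluthge])
      (auto simp: orb_invertible)
  then show ?case by (simp add: o_def)
qed (simp add: continuous_on_id)

lemma tendsto_orb:
  fixes X :: "nat \<Rightarrow> complex^'n^'n"
  assumes "X \<longlonglongrightarrow> T" "\<And>k. invertible (X k)" "invertible T"
  shows "(\<lambda>k. orb n (X k)) \<longlonglongrightarrow> orb n T"
  using continuous_on_orb[of n] assms unfolding continuous_on_sequentially by (auto simp: o_def)

text \<open>Equality of spectra with multiplicities, in a form that is clearly invariant under
  similarity and closed under limits.\<close>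

definition same_traces :: "complex^'n^'n \<Rightarrow> complex^'n^'n \<Rightarrow> bool" where
  "same_traces A B \<longleftrightarrow> (\<forall>p. trace (matpoly p A) = trace (matpoly p B))"

lemma same_traces_trans: "same_traces A B \<Longrightarrow> same_traces B C \<Longrightarrow> same_traces A C"
  by (simp add: same_traces_def)

lemma same_traces_sym: "same_traces A B \<Longrightarrow> same_traces B A"
  by (simp add: same_traces_def)

lemma same_traces_similar:
  fixes A G G' :: "complex^'n^'n"
  assumes "G' ** G = mat 1" shows "same_traces (G ** A ** G') A"
proof -
  have "trace (G ** matpoly p A ** G') = trace (matpoly p A)" for p
    using trace_mul_sym[of "G ** matpoly p A" G'] assms by (simp add: matrix_mul_assoc)
  then show ?thesis by (simp add: same_traces_def matpoly_similar[OF assms])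
qed

lemma same_traces_orb: "invertible T \<Longrightarrow> same_traces (orb n T) T"
proof (induction n)
  case (Suc n)
  obtain S U where SU: "polar (orb n T) S U"
    using polar_exists orb_invertible Suc.prems by blast
  have "same_traces (orb (Suc n) T) (orb n T)"
    using same_traces_similar[OF polarD(8)[OF SU]] by (simp add: aluthge_similar[OF SU])
  then show ?case using Suc same_traces_trans by blast
qed (simp add: same_traces_def)

lemma same_traces_limit:
  fixes X Y :: "nat \<Rightarrow> complex^'n^'n"
  assumes "X \<longlonglongrightarrow> A" "Y \<longlonglongrightarrow> B" "\<And>k. same_traces (X k) (Y k)"
  shows "same_traces A B"
  unfolding same_traces_def
proof
  fix p
  have tr: "(\<lambda>k. trace (matpoly p (Z k))) \<longlonglongrightarrow> trace (matpoly p C)"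
    if "Z \<longlonglongrightarrow> C" for Z and C :: "complex^'n^'n"
    unfolding trace_def by (intro tendsto_intros tendsto_matpoly that)
  show "trace (matpoly p A) = trace (matpoly p B)"
    using tr[OF assms(1)] tr[OF assms(2)] assms(3) by (auto simp: same_traces_def intro: LIMSEQ_unique)
qed

text \<open>The inverses are bounded, so a subsequence of them converges, and its limit inverts
  \<open>A\<close>.\<close>

lemma invertible_limit:
  fixes X :: "nat \<Rightarrow> complex^'n^'n"
  assumes X: "X \<longlonglongrightarrow> A" and inv: "\<And>k. invertible (X k)" "\<And>k. norm (matrix_inv (X k)) \<le> B"
  shows "invertible A"
proof -
  have "bounded (range (\<lambda>k. matrix_inv (X k)))" using inv(2) unfolding bounded_iff by blast
  then obtain l r where r: "strict_mono r" "((\<lambda>k. matrix_inv (X k)) \<circ> r) \<longlonglongrightarrow> l"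
    using bounded_imp_convergent_subsequence by blast
  have "(\<lambda>k. (X \<circ> r) k ** ((\<lambda>k. matrix_inv (X k)) \<circ> r) k) \<longlonglongrightarrow> A ** l"
    by (intro mm.tendsto r LIMSEQ_subseq_LIMSEQ[OF X])
  then have "A ** l = mat 1"
    by (simp add: matrix_inv_mult[OF inv(1)] LIMSEQ_const_iff)
  then show ?thesis by (rule matrix_inv_eqI)
qed

text \<open>Norms decrease along the orbit, so a limit point \<open>R\<close> has norm at most that
  of every iterate. By continuity its transform is a limit of iterates too, so the norm of
  \<open>R\<close> cannot drop and \<open>R\<close> is normal.\<close>

lemma orb_normal_limit_point:
  fixes T :: "complex^'n^'n"
  assumes T: "invertible T"
  obtains R r where "strict_mono r" "(\<lambda>k. orb (r k) T) \<longlonglongrightarrow> R" "normal_mat R" "same_traces R T"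
    "\<And>n. norm R \<le> norm (orb n T)"
proof -
  have "bounded (range (\<lambda>n. orb n T))"
    using norm_orb_le[OF T] unfolding bounded_iff by blast
  then obtain R r where r: "strict_mono r" and R: "((\<lambda>n. orb n T) \<circ> r) \<longlonglongrightarrow> R"
    using bounded_imp_convergent_subsequence by blast
  have R': "(\<lambda>k. orb (r k) T) \<longlonglongrightarrow> R" using R by (simp add: o_def)
  have iR: "invertible R"
    by (rule invertible_limit[OF R']) (use orb_invertible[OF T] norm_inv_orb_le[OF T] in auto)
  have le: "norm R \<le> norm (orb n T)" for n
  proof (rule LIMSEQ_le_const2[OF tendsto_norm[OF R']])
    have "norm (orb (r k) T) \<le> norm (orb n T)" if "k \<ge> n" for k
      using norm_orb_mono[OF T] that seq_suble[OF r, of k] by simp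
    then show "\<exists>N. \<forall>k\<ge>N. norm (orb (r k) T) \<le> norm (orb n T)" by blast
  qed
  have "norm R \<le> norm (aluthge R)"
  proof (rule LIMSEQ_le_const)
    have "(\<lambda>k. orb 1 (orb (r k) T)) \<longlonglongrightarrow> orb 1 R"
      by (rule tendsto_orb[OF R' _ iR]) (simp add: orb_invertible T)
    then show "(\<lambda>k. norm (orb (Suc (r k)) T)) \<longlonglongrightarrow> norm (aluthge R)"
      using tendsto_norm by fastforce
  qed (use le in blast)
  then have "normal_mat R"
    using aluthge_norm_eq_imp_normal[OF iR] norm_aluthge_le[OF iR] by simp
  moreover have "same_traces R T"
    by (rule same_traces_limit[OF R' tendsto_const]) (rule same_traces_orb[OF T])
  ultimately show ?thesis using that r R' le by blast
qed

section \<open>Eigenvalues of normal matrices with equal traces\<close>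

lemma matpoly_diag_mat: "matpoly p (diag_mat d) = diag_mat (\<lambda>i. poly p (d i))"
proof (induction p)
  case 0
  show ?case by (simp add: diag_mat_def vec_eq_iff)
next
  case (pCons a p)
  have "mat a + diag_mat f = diag_mat (\<lambda>i. a + f i)" for f :: "'a \<Rightarrow> complex"
    by (simp add: diag_mat_def mat_def vec_eq_iff)
  then show ?case by (simp add: pCons diag_mat_mult)
qed

lemma matpoly_unitary_diag:
  assumes "unitary_mat V"
  shows "matpoly p (V ** diag_mat d ** V\<^sup>H) = V ** diag_mat (\<lambda>i. poly p (d i)) ** V\<^sup>H"
  using assms by (simp add: matpoly_similar unitary_mat_def matpoly_diag_mat)

lemma trace_unitary_diag:
  assumes "unitary_mat V"
  shows "trace (V ** diag_mat d ** V\<^sup>H) = (\<Sum>i\<in>UNIV. d i)"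
proof -
  have "trace (V ** diag_mat d ** V\<^sup>H) = trace (diag_mat d)"
    using trace_mul_sym[of "V ** diag_mat d" "V\<^sup>H"] assms by (simp add: matrix_mul_assoc unitary_mat_def)
  then show ?thesis by (simp add: trace_def diag_mat_def)
qed

text \<open>Interpolation on the finitely many eigenvalues replaces an arbitrary function
  \<open>g\<close> by a polynomial, for which the sums are traces.\<close>

lemma same_traces_eigenvalues:
  fixes d d' :: "'n::finite \<Rightarrow> complex"
  assumes "unitary_mat V" "unitary_mat V'"
    and "same_traces (V ** diag_mat d ** V\<^sup>H) (V' ** diag_mat d' ** V'\<^sup>H)"
  shows "(\<Sum>i\<in>UNIV. g (d i)) = (\<Sum>i\<in>UNIV. (g :: complex \<Rightarrow> complex) (d' i))"
proof -
  obtain p where p: "\<forall>z\<in>range d \<union> range d'. poly p z = g z"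
    using poly_interpolation[of "range d \<union> range d'" g] by auto
  have "(\<Sum>i\<in>UNIV. poly p (d i)) = (\<Sum>i\<in>UNIV. poly p (d' i))"
    using assms(3) by (simp add: same_traces_def matpoly_unitary_diag trace_unitary_diag assms)
  then show ?thesis using p by simp
qed

lemma norm_unitary_diag:
  assumes "unitary_mat V"
  shows "of_real ((norm (V ** diag_mat d ** V\<^sup>H))\<^sup>2) = (\<Sum>i\<in>UNIV. d i * cnj (d i))"
proof -
  have "norm (V ** diag_mat d ** V\<^sup>H) = norm (diag_mat d)"
    using assms by (simp add: unitary_norm_left unitary_norm_right unitary_adjoint)
  moreover have "(norm (diag_mat d))\<^sup>2 = (\<Sum>i\<in>UNIV. (cmod (d i))\<^sup>2)"
    unfolding norm_mat_sq by (simp add: diag_mat_def if_distrib[of cmod] if_distrib[of "\<lambda>x. x\<^sup>2"] cong: if_cong)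
  ultimately show ?thesis by (simp add: complex_norm_square del: of_real_power)
qed

lemma normal_same_traces_norm_eq:
  assumes "normal_mat A" "normal_mat B" "same_traces A B"
  shows "norm A = norm B"
proof -
  obtain V d where V: "unitary_mat V" "A = V ** diag_mat d ** V\<^sup>H"
    using normal_mat_diagonalization assms by blast
  obtain V' d' where V': "unitary_mat V'" "B = V' ** diag_mat d' ** V'\<^sup>H"
    using normal_mat_diagonalization assms by blast
  have "complex_of_real ((norm A)\<^sup>2) = of_real ((norm B)\<^sup>2)"
    using same_traces_eigenvalues[OF V(1) V'(1), of d d' "\<lambda>z. z * cnj z"] assms(3)
    unfolding V(2) V'(2) norm_unitary_diag[OF V(1)] norm_unitary_diag[OF V'(1)] by simp
  then show ?thesis by (simp only: of_real_eq_iff power2_eq_iff_nonneg norm_ge_zero)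
qed

lemma normal_common_spectrum:
  fixes T :: "complex^'n^'n"
  obtains L where "finite L" "\<And>R. normal_mat R \<Longrightarrow> same_traces R T \<Longrightarrow>
    \<exists>V d. unitary_mat V \<and> R = V ** diag_mat d ** V\<^sup>H \<and> range d \<subseteq> L"
proof (cases "\<exists>R. normal_mat R \<and> same_traces R T")
  case True
  then obtain R0 where R0: "normal_mat R0" "same_traces R0 T" by blast
  then obtain V0 d0 where V0: "unitary_mat V0" "R0 = V0 ** diag_mat d0 ** V0\<^sup>H"
    using normal_mat_diagonalization by blast
  show ?thesis
  proof (rule that[of "range d0"])
    fix R assume R: "normal_mat R" "same_traces R T"
    then obtain V d where V: "unitary_mat V" "R = V ** diag_mat d ** V\<^sup>H"
      using normal_mat_diagonalization by blast
    have st: "same_traces R R0" using R R0 same_traces_trans same_traces_sym by blast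
    \<comment> \<open>The indicator of the complement of the reference spectrum: its sum over the
      eigenvalues of \<open>R\<close> is 0 and has nonnegative terms, so no eigenvalue lies
      outside.\<close>
    define g :: "complex \<Rightarrow> complex" where "g z = (if z \<in> range d0 then 0 else 1)" for z
    have "(\<Sum>i\<in>UNIV. g (d i)) = (\<Sum>i\<in>UNIV. g (d0 i))"
      using same_traces_eigenvalues[OF V(1) V0(1)] st V V0 by simp
    also have "\<dots> = 0" by (simp add: g_def)
    finally have "(\<Sum>i\<in>UNIV. Re (g (d i))) = 0" by (simp flip: Re_sum)
    then have "\<forall>i\<in>UNIV. Re (g (d i)) = 0"
      by (subst (asm) sum_nonneg_eq_0_iff) (auto simp: g_def)
    then have "range d \<subseteq> range d0" by (auto simp: g_def split: if_splits)
    then show "\<exists>V d. unitary_mat V \<and> R = V ** diag_mat d ** V\<^sup>H \<and> range d \<subseteq> range d0"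
      using V by blast
  qed simp
qed (use that[of "{}"] in auto)

text \<open>The identity \<open>Y = Y0 - Y ** (T - T0) ** Y0\<close> bounds the norm of
  \<open>Y\<close> by that of \<open>Y0\<close> plus half of itself.\<close>

lemma matrix_inv_bound_near:
  fixes T T0 :: "complex^'n^'n"
  assumes "invertible T" "invertible T0" "norm (T - T0) * norm (matrix_inv T0) \<le> 1/2"
  shows "norm (matrix_inv T) \<le> 2 * norm (matrix_inv T0)"
proof -
  define Y where "Y = matrix_inv T"
  define Y0 where "Y0 = matrix_inv T0"
  note i = matrix_inv_mult[OF assms(1), folded Y_def] matrix_inv_mult[OF assms(2), folded Y0_def]
  have "Y = Y0 - Y ** (T - T0) ** Y0"
    by (simp add: mat_distrib i mult_cancel_left)
  then have "norm Y \<le> norm Y0 + norm (Y ** (T - T0) ** Y0)"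
    by (metis norm_triangle_ineq4)
  also have "norm (Y ** (T - T0) ** Y0) \<le> norm Y * norm (T - T0) * norm Y0"
    by (meson norm_mat_mult_le mult_right_mono norm_ge_zero order_trans)
  also have "\<dots> \<le> norm Y * (1/2)"
    using assms(3) unfolding mult.assoc Y0_def by (intro mult_left_mono) auto
  finally show ?thesis by (simp add: Y_def Y0_def)
qed

text \<open>A limit point of late iterates of matrices tending to \<open>T0\<close> has norm at most that of a normal
  limit point of the orbit of \<open>T0\<close>, which equals that of a normal limit point of its own orbit; so
  \<open>\<Delta>\<close> does not decrease its norm and it is normal.\<close>

lemma orb_uniformly_normal:
  fixes T0 :: "complex^'n^'n" and g :: "complex^'n^'n \<Rightarrow> real"
  assumes T0: "invertible T0" and g: "continuous_on UNIV g"
    and g0: "\<And>R. normal_mat R \<Longrightarrow> same_traces R T0 \<Longrightarrow> g R = 0" and e: "e > 0"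
  obtains n0 \<delta> where "\<delta> > 0"
    "\<And>T n. invertible T \<Longrightarrow> dist T T0 < \<delta> \<Longrightarrow> n \<ge> n0 \<Longrightarrow> g (orb n T) < e"
proof (rule ccontr)
  note witness = that
  assume "\<not> thesis"
  then have neg: "\<exists>T n. invertible T \<and> dist T T0 < \<delta> \<and> n \<ge> n0 \<and> g (orb n T) \<ge> e" if "\<delta> > 0" for n0 \<delta>
    using witness[of \<delta> n0] that by (meson not_less)
  define N where "N = norm (matrix_inv T0)"
  \<comment> \<open>This radius satisfies both \<open>c * N \<le> 1/2\<close>, for the bound on
    nearby inverses, and \<open>c \<le> 1\<close>.\<close>
  define c where "c = 1 / (2 * N + 1)"
  have N: "N \<ge> 0" by (simp add: N_def)
  then have c: "c > 0" "c * N \<le> 1/2" "c \<le> 1" by (simp_all add: c_def field_simps)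
  \<comment> \<open>Failure of the claim yields counterexamples tending to \<open>T0\<close> whose
    iteration counts exceed every bound.\<close>
  have "\<forall>k. \<exists>T n. invertible T \<and> dist T T0 < c / (real k + 1) \<and> n \<ge> k \<and> g (orb n T) \<ge> e"
    using neg c by simp
  then obtain T n where T: "\<And>k. invertible (T k)" "\<And>k. dist (T k) T0 < c / (real k + 1)"
    "\<And>k. n k \<ge> k" "\<And>k. g (orb (n k) (T k)) \<ge> e" by metis
  have Tlim: "T \<longlonglongrightarrow> T0"
  proof (rule iffD2[OF tendsto_dist_iff], rule Lim_null_comparison)
    show "\<forall>\<^sub>F k in sequentially. norm (dist (T k) T0) \<le> c * inverse (real (Suc k))"
      using T(2) by (intro always_eventually allI) (simp add: field_simps less_imp_le)
  qed (intro tendsto_mult_right_zero LIMSEQ_inverse_real_of_nat)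
  have Tc: "norm (T k - T0) < c" for k
  proof -
    have "c / (real k + 1) \<le> c" using c by (simp add: divide_le_eq)
    then show ?thesis using T(2)[of k] by (simp add: dist_norm)
  qed
  have inv: "norm (matrix_inv (T k)) \<le> 2 * N" for k
  proof -
    have "norm (T k - T0) * N \<le> c * N" using Tc[of k] N by (intro mult_right_mono) auto
    then show ?thesis using matrix_inv_bound_near[OF T(1) T0] c by (simp add: N_def)
  qed
  define X where "X k = orb (n k) (T k)" for k
  have "norm (X k) \<le> norm T0 + 1" for k
    using norm_orb_le[OF T(1), of "n k" k] Tc[of k] c norm_triangle_sub[of "T k" T0] by (simp add: X_def)
  then have "bounded (range X)" unfolding bounded_iff by blast
  then obtain R r where r: "strict_mono r" and "(X \<circ> r) \<longlonglongrightarrow> R"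
    using bounded_imp_convergent_subsequence by blast
  then have R: "(\<lambda>k. X (r k)) \<longlonglongrightarrow> R" by (simp add: o_def)
  have Tr: "(\<lambda>k. T (r k)) \<longlonglongrightarrow> T0" using LIMSEQ_subseq_LIMSEQ[OF Tlim r] by (simp add: o_def)
  have iR: "invertible R"
    by (rule invertible_limit[OF R, of "2 * N"])
      (simp_all add: X_def orb_invertible T order_trans[OF norm_inv_orb_le[OF T(1)] inv])
  have trR: "same_traces R T0"
    by (rule same_traces_limit[OF R Tr]) (simp add: X_def same_traces_orb T)
  have leR: "norm R \<le> norm (orb m T0)" for m
  proof (rule LIMSEQ_le[OF tendsto_norm[OF R]])
    show "(\<lambda>k. norm (orb m (T (r k)))) \<longlonglongrightarrow> norm (orb m T0)"
      by (intro tendsto_norm tendsto_orb Tr T T0)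
    have "norm (X (r k)) \<le> norm (orb m (T (r k)))" if "k \<ge> m" for k
      unfolding X_def using that seq_suble[OF r, of k] T(3)[of "r k"]
      by (intro norm_orb_mono T) linarith
    then show "\<exists>N. \<forall>k\<ge>N. norm (X (r k)) \<le> norm (orb m (T (r k)))" by blast
  qed
  obtain R0 r0 where R0: "(\<lambda>k. orb (r0 k) T0) \<longlonglongrightarrow> R0" "normal_mat R0" "same_traces R0 T0"
    using orb_normal_limit_point[OF T0] by metis
  have RR0: "norm R \<le> norm R0"
    by (rule LIMSEQ_le_const[OF tendsto_norm[OF R0(1)]]) (use leR in blast)
  obtain R1 where R1: "normal_mat R1" "same_traces R1 R" "norm R1 \<le> norm (orb 1 R)"
    using orb_normal_limit_point[OF iR] by metis
  have "norm R1 = norm R0"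
    using normal_same_traces_norm_eq[OF R1(1) R0(2)] R1(2) trR R0(3) same_traces_trans same_traces_sym
    by blast
  then have "norm (aluthge R) = norm R"
    using RR0 R1(3) norm_aluthge_le[OF iR] by simp
  then have "normal_mat R" by (rule aluthge_norm_eq_imp_normal[OF iR])
  then have "g R = 0" using g0 trR by blast
  moreover have "(\<lambda>k. g (X (r k))) \<longlonglongrightarrow> g R"
    using g R by (simp add: continuous_on_eq_continuous_at continuous_at_sequentially o_def)
  then have "e \<le> g R"
    by (rule LIMSEQ_le_const) (use T(4) in \<open>auto simp: X_def\<close>)
  ultimately show False using e by simp
qed

subsection \<open>Uniform convergence of the orbits\<close>

lemma orb_bounds_near:
  fixes T0 :: "complex^'n^'n"
  assumes T0: "invertible T0"
  obtains B1 B2 \<delta> where "\<delta> > 0" "B1 \<ge> 0" "B2 \<ge> 0"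
    "\<And>T n. invertible T \<Longrightarrow> dist T T0 < \<delta> \<Longrightarrow> norm (orb n T) \<le> B1 \<and> norm (matrix_inv (orb n T)) \<le> B2"
proof -
  define N where "N = norm (matrix_inv T0)"
  define c where "c = 1 / (2 * N + 1)"
  have N: "N \<ge> 0" by (simp add: N_def)
  then have c: "c > 0" "c * N \<le> 1/2" "c \<le> 1" by (simp_all add: c_def field_simps)
  show ?thesis
  proof (rule that[of c "norm T0 + 1" "2 * N"])
    fix T n assume T: "invertible T" "dist T T0 < c"
    have "norm (T - T0) * N \<le> c * N" using T(2) N by (intro mult_right_mono) (auto simp: dist_norm)
    then have "norm (matrix_inv T) \<le> 2 * N"
      using matrix_inv_bound_near[OF T(1) T0] c by (simp add: N_def)
    moreover have "norm T \<le> norm T0 + 1"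
      using T(2) c norm_triangle_sub[of T T0] by (simp add: dist_norm)
    ultimately show "norm (orb n T) \<le> norm T0 + 1 \<and> norm (matrix_inv (orb n T)) \<le> 2 * N"
      using norm_orb_le[OF T(1), of n] norm_inv_orb_le[OF T(1), of n] by linarith
  qed (use N c in auto)
qed

text \<open>The steps are dominated by a geometric series. Carrying the remaining tail
  \<open>C * f k\<close> in the induction makes the bound reproduce itself.\<close>

lemma geometric_drift:
  fixes E :: "nat \<Rightarrow> 'a::real_normed_vector"
  assumes f: "\<And>k. f (Suc k) \<le> \<rho> * f k" "\<And>k. f k \<ge> 0"
    and E: "\<And>k. norm (E (Suc k) - E k) \<le> C * f k" and \<rho>: "\<rho> < 1" and C: "C \<ge> 0"
  shows "norm (E k - E 0) \<le> C * f 0 / (1 - \<rho>)"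
proof -
  have "norm (E k - E 0) * (1 - \<rho>) + C * f k \<le> C * f 0"
  proof (induction k)
    case (Suc k)
    have "norm (E (Suc k) - E 0) \<le> C * f k + norm (E k - E 0)"
      using norm_triangle_ineq[of "E (Suc k) - E k" "E k - E 0"] E[of k] by simp
    then have "norm (E (Suc k) - E 0) * (1 - \<rho>) \<le> (C * f k + norm (E k - E 0)) * (1 - \<rho>)"
      using \<rho> by (intro mult_right_mono) auto
    moreover have "C * f (Suc k) \<le> C * (\<rho> * f k)" using f C by (intro mult_left_mono) auto
    ultimately show ?case using Suc by (simp add: algebra_simps)
  qed simp
  moreover have "C * f k \<ge> 0" using f C by simp
  ultimately have "norm (E k - E 0) * (1 - \<rho>) \<le> C * f 0" by linarith
  then show ?thesis using \<rho> by (simp add: pos_le_divide_eq)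
qed

lemma skew_diff_le: "norm (skew E) \<le> norm (skew A) + 2 * norm (E - A)" for A E :: "complex^'n^'n"
proof -
  have "skew E = skew A + ((E - A) - (E - A)\<^sup>H)" by (simp add: skew_def adjoint_diff)
  then have "norm (skew E) \<le> norm (skew A) + (norm (E - A) + norm ((E - A)\<^sup>H))"
    by (simp only: order_trans[OF norm_triangle_ineq add_left_mono[OF norm_triangle_ineq4]])
  then show ?thesis by simp
qed

text \<open>From a common index on, \<open>matpoly p\<close> of each iterate is nearly an orthogonal
  projection. Newton iteration replaces it by an exact idempotent commuting with the iterate, the
  Aluthge similarities carry these idempotents into one another, and geometric decay of their skew
  parts bounds the total drift uniformly.\<close>

lemma matpoly_orb_uniformly_Cauchy:
  fixes T0 :: "complex^'n^'n"
  assumes T0: "invertible T0"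
    and p0: "\<And>R. normal_mat R \<Longrightarrow> same_traces R T0 \<Longrightarrow>
      matpoly p R ** matpoly p R = matpoly p R \<and> skew (matpoly p R) = 0"
    and eps: "\<epsilon> > 0"
  obtains n0 \<delta> where "\<delta> > 0" "\<And>T n. invertible T \<Longrightarrow> dist T T0 < \<delta> \<Longrightarrow> n \<ge> n0 \<Longrightarrow>
    norm (matpoly p (orb n T) - matpoly p (orb n0 T)) \<le> \<epsilon>"
proof -
  obtain B1 B2 \<delta>1 where B: "\<delta>1 > 0" "B1 \<ge> 0" "B2 \<ge> 0"
    "\<And>T n. invertible T \<Longrightarrow> dist T T0 < \<delta>1 \<Longrightarrow> norm (orb n T) \<le> B1 \<and> norm (matrix_inv (orb n T)) \<le> B2"
    using orb_bounds_near[OF T0] by metis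
  obtain M where M: "M \<ge> 0" "\<And>T :: complex^'n^'n. norm T \<le> B1 \<Longrightarrow> norm (matpoly p T) \<le> M"
    using matpoly_bounded by blast
  obtain \<eta> \<rho> where \<eta>: "\<eta> > 0" and \<rho>: "0 \<le> \<rho>" "\<rho> < 1" and contr:
    "\<And>T S U E :: complex^'n^'n. polar T S U \<Longrightarrow> E ** T = T ** E \<Longrightarrow> E ** E = E \<Longrightarrow> norm T \<le> B1 + M + 1 \<Longrightarrow>
       norm E \<le> B1 + M + 1 \<Longrightarrow> norm (E - matpoly p T) \<le> \<eta> \<Longrightarrow> norm (skew E) \<le> \<eta> \<Longrightarrow>
       norm (skew (S ** E ** matrix_inv S)) \<le> \<rho> * norm (skew E)"
    using skew_contraction[of "B1 + M + 1" p] by metis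
  define K where "K = M + 1"
  define c where "c = 2 * (1 + 2 * K)"
  define C where "C = 1 + B1 * B2"
  have c: "c \<ge> 1" using M by (simp add: c_def K_def)
  have C: "C \<ge> 1" using B by (simp add: C_def)
  \<comment> \<open>The drift of the idempotents contributes the first summand; the two replacements
    of \<open>A\<close> by \<open>E\<close>, at the start and at the end, contribute
    \<open>2 * c\<close>.\<close>
  define D where "D = C * (1 + 2 * c) / (1 - \<rho>) + 2 * c"
  have D: "D > 0" using C c \<rho> unfolding D_def by (intro add_nonneg_pos divide_nonneg_pos mult_nonneg_nonneg) auto
  \<comment> \<open>In order: for halving the Newton defect, for keeping the idempotents within
    distance 1 of \<open>A k\<close>, for the threshold \<open>\<eta>\<close> of the contraction,
    and for the final error \<open>\<epsilon>\<close>.\<close>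
  define e where "e = Min {1/8, 1/c, \<eta> / (1 + 2 * c), \<epsilon> / D}"
  have e0: "e > 0" using c \<eta> D eps by (simp add: e_def)
  have "e \<le> 1/8" "e \<le> 1/c" "e \<le> \<eta> / (1 + 2 * c)" "e \<le> \<epsilon> / D"
    unfolding e_def by (intro Min_le; simp)+
  then have e: "e \<le> 1/8" "c * e \<le> 1" "(1 + 2 * c) * e \<le> \<eta>" "D * e \<le> \<epsilon>"
    using c D by (simp_all add: pos_le_divide_eq mult.commute)
  define g where "g T = norm (matpoly p T ** matpoly p T - matpoly p T) + norm (skew (matpoly p T))"
    for T :: "complex^'n^'n"
  have contg: "continuous_on UNIV g"
    unfolding g_def skew_def
    by (intro continuous_intros mm.continuous_on continuous_on_adjoint)
  have g0: "g R = 0" if "normal_mat R" "same_traces R T0" for R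
    using p0[OF that] by (simp add: g_def)
  obtain n0 \<delta>2 where \<delta>2: "\<delta>2 > 0"
    "\<And>T n. invertible T \<Longrightarrow> dist T T0 < \<delta>2 \<Longrightarrow> n \<ge> n0 \<Longrightarrow> g (orb n T) < e"
    using orb_uniformly_normal[OF T0 contg g0 e0] by metis
  show ?thesis
  proof (rule that[of "min \<delta>1 \<delta>2" n0])
    show "min \<delta>1 \<delta>2 > 0" using B \<delta>2 by simp
    fix T n assume T: "invertible T" "dist T T0 < min \<delta>1 \<delta>2" and n: "n \<ge> n0"
    define Y where "Y k = orb (n0 + k) T" for k
    define A where "A k = matpoly p (Y k)" for k
    have Ybd: "norm (Y k) \<le> B1" "norm (matrix_inv (Y k)) \<le> B2" for k
      using B(4) T by (simp_all add: Y_def)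
    have gA: "norm (A k ** A k - A k) \<le> e" "norm (skew (A k)) \<le> e" for k
      using \<delta>2(2)[of T "n0 + k"] T norm_ge_zero[of "A k ** A k - A k"] norm_ge_zero[of "skew (A k)"]
      by (simp_all add: g_def A_def Y_def del: norm_ge_zero)
    have A_M: "norm (A k) \<le> M" for k using M(2) Ybd by (simp add: A_def)
    have "\<exists>E. (\<lambda>j. (newton ^^ j) (A k)) \<longlonglongrightarrow> E \<and> E ** E = E \<and> norm (E - A k) \<le> c * e" for k
    proof (rule newton_idempotent[of "A k" K e])
      show "norm (A k) + 1 \<le> K" using A_M by (simp add: K_def)
    qed (use gA e in \<open>auto simp: c_def\<close>)
    then obtain E where E: "\<And>k. (\<lambda>j. (newton ^^ j) (A k)) \<longlonglongrightarrow> E k" "\<And>k. E k ** E k = E k"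
      "\<And>k. norm (E k - A k) \<le> c * e" by metis
    have comm: "E k ** Y k = Y k ** E k" for k
    proof (rule LIMSEQ_unique)
      show "(\<lambda>j. (newton ^^ j) (A k) ** Y k) \<longlonglongrightarrow> E k ** Y k" by (intro mm.tendsto E tendsto_const)
      have "(newton ^^ j) (A k) ** Y k = Y k ** (newton ^^ j) (A k)" for j
        unfolding A_def by (intro newton_commute matpoly_commute refl)
      then show "(\<lambda>j. (newton ^^ j) (A k) ** Y k) \<longlonglongrightarrow> Y k ** E k"
        by (simp only:) (intro mm.tendsto E tendsto_const)
    qed
    have skE: "norm (skew (E k)) \<le> (1 + 2 * c) * e" for k
      using skew_diff_le[of "E k" "A k"] gA(2)[of k] E(3)[of k] by (simp add: algebra_simps)
    have "\<exists>S U. polar (Y k) S U" for k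
      using polar_exists[OF orb_invertible[OF T(1)]] unfolding Y_def by blast
    then obtain S U where SU: "\<And>k. polar (Y k) (S k) (U k)" by metis
    have YS: "Y (Suc k) = S k ** Y k ** matrix_inv (S k)" for k
      using aluthge_similar[OF SU[of k]] by (simp add: Y_def)
    \<comment> \<open>Newton iterates commute with similarities, so both sides are limits of one
      sequence.\<close>
    have ES: "E (Suc k) = S k ** E k ** matrix_inv (S k)" for k
    proof (rule LIMSEQ_unique[OF E(1)])
      note i = polarD(8)[OF SU[of k]]
      have "(newton ^^ j) (A (Suc k)) = S k ** (newton ^^ j) (A k) ** matrix_inv (S k)" for j
        by (simp add: A_def YS matpoly_similar[OF i] newton_similar[OF i])
      then show "(\<lambda>j. (newton ^^ j) (A (Suc k))) \<longlonglongrightarrow> S k ** E k ** matrix_inv (S k)"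
        by (simp only:) (intro mm.tendsto E tendsto_const)
    qed
    have f: "norm (skew (E (Suc k))) \<le> \<rho> * norm (skew (E k))" for k
      unfolding ES
    proof (rule contr[OF SU comm E(2)])
      show "norm (Y k) \<le> B1 + M + 1" using Ybd(1)[of k] M(1) by simp
      show "norm (E k) \<le> B1 + M + 1"
        using A_M[of k] E(3)[of k] e(2) B(2) norm_triangle_sub[of "E k" "A k"] by linarith
      have "c * e \<le> (1 + 2 * c) * e" using c e0 by (intro mult_right_mono) auto
      then show "norm (E k - matpoly p (Y k)) \<le> \<eta>" using E(3)[of k] e(3) by (simp add: A_def)
      show "norm (skew (E k)) \<le> \<eta>" using skE[of k] e(3) by linarith
    qed
    have d: "norm (E (Suc k) - E k) \<le> C * norm (skew (E k))" for k
    proof -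
      have "norm (E (Suc k) - E k) \<le> (1 + norm (Y k) * norm (matrix_inv (Y k))) * norm (skew (E k))"
        unfolding ES by (rule commuting_step_le[OF SU comm])
      also have "\<dots> \<le> C * norm (skew (E k))"
        unfolding C_def by (intro mult_right_mono add_left_mono mult_mono Ybd B) auto
      finally show ?thesis .
    qed
    define k where "k = n - n0"
    have "norm (E k - E 0) \<le> C * norm (skew (E 0)) / (1 - \<rho>)"
      by (rule geometric_drift[where f = "\<lambda>k. norm (skew (E k))"]) (use f d \<rho> C in auto)
    also have "\<dots> \<le> C * ((1 + 2 * c) * e) / (1 - \<rho>)"
      using skE[of 0] C \<rho> by (intro divide_right_mono mult_left_mono) auto
    finally have "norm (E k - E 0) \<le> C * (1 + 2 * c) / (1 - \<rho>) * e" by (simp add: mult_ac)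
    moreover have "norm (A k - A 0) \<le> norm (E k - A k) + norm (E k - E 0) + norm (E 0 - A 0)"
    proof -
      have "A k - A 0 = (E k - E 0) - (E k - A k) + (E 0 - A 0)" by simp
      then have "norm (A k - A 0) \<le> norm (E k - E 0) + norm (E k - A k) + norm (E 0 - A 0)"
        by (simp only: order_trans[OF norm_triangle_ineq add_right_mono[OF norm_triangle_ineq4]])
      then show ?thesis by simp
    qed
    ultimately have "norm (A k - A 0) \<le> D * e"
      using E(3)[of k] E(3)[of 0] unfolding D_def distrib_right by linarith
    also note e(4)
    finally show "norm (matpoly p (orb n T) - matpoly p (orb n0 T)) \<le> \<epsilon>"
      using n by (simp add: A_def Y_def k_def)
  qed
qed

text \<open>A Cauchy condition joint in \<open>n\<close> and \<open>T\<close>. The centre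
  \<open>L\<close> may depend on \<open>\<epsilon>\<close>, so no limit has to be known
  beforehand.\<close>

definition orb_uniform_limit :: "(complex^'n^'n \<Rightarrow> complex^'n^'n) \<Rightarrow> complex^'n^'n \<Rightarrow> bool" where
  "orb_uniform_limit \<phi> T0 \<longleftrightarrow> (\<forall>\<epsilon>>0. \<exists>L n0. \<exists>\<delta>>0. \<forall>T n. invertible T \<longrightarrow> dist T T0 < \<delta> \<longrightarrow> n \<ge> n0 \<longrightarrow>
     norm (\<phi> (orb n T) - L) \<le> \<epsilon>)"

lemma orb_uniform_limitD:
  assumes "orb_uniform_limit \<phi> T0" "\<epsilon> > 0"
  obtains L n0 \<delta> where "\<delta> > 0"
    "\<And>T n. invertible T \<Longrightarrow> dist T T0 < \<delta> \<Longrightarrow> n \<ge> n0 \<Longrightarrow> norm (\<phi> (orb n T) - L) \<le> \<epsilon>"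
  using assms unfolding orb_uniform_limit_def by meson

lemma orb_uniform_limit_add:
  assumes "orb_uniform_limit \<phi> T0" "orb_uniform_limit \<psi> T0"
  shows "orb_uniform_limit (\<lambda>T. \<phi> T + \<psi> T) T0"
  unfolding orb_uniform_limit_def
proof (intro allI impI)
  fix \<epsilon> :: real assume "\<epsilon> > 0"
  then have "\<epsilon> / 2 > 0" by simp
  obtain L1 n1 \<delta>1 where 1: "\<delta>1 > 0"
    "\<And>T n. invertible T \<Longrightarrow> dist T T0 < \<delta>1 \<Longrightarrow> n \<ge> n1 \<Longrightarrow> norm (\<phi> (orb n T) - L1) \<le> \<epsilon> / 2"
    using orb_uniform_limitD[OF assms(1) \<open>\<epsilon> / 2 > 0\<close>] by metis
  obtain L2 n2 \<delta>2 where 2: "\<delta>2 > 0"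
    "\<And>T n. invertible T \<Longrightarrow> dist T T0 < \<delta>2 \<Longrightarrow> n \<ge> n2 \<Longrightarrow> norm (\<psi> (orb n T) - L2) \<le> \<epsilon> / 2"
    using orb_uniform_limitD[OF assms(2) \<open>\<epsilon> / 2 > 0\<close>] by metis
  show "\<exists>L n0. \<exists>\<delta>>0. \<forall>T n. invertible T \<longrightarrow> dist T T0 < \<delta> \<longrightarrow> n0 \<le> n \<longrightarrow>
     norm (\<phi> (orb n T) + \<psi> (orb n T) - L) \<le> \<epsilon>"
  proof (rule exI[of _ "L1 + L2"], rule exI[of _ "max n1 n2"], rule exI[of _ "min \<delta>1 \<delta>2"],
      intro conjI allI impI)
    fix T n assume T: "invertible T" "dist T T0 < min \<delta>1 \<delta>2" "max n1 n2 \<le> n"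
    have "norm (\<phi> (orb n T) + \<psi> (orb n T) - (L1 + L2)) \<le> norm (\<phi> (orb n T) - L1) + norm (\<psi> (orb n T) - L2)"
      by (rule norm_diff_triangle_ineq)
    also have "\<dots> \<le> \<epsilon> / 2 + \<epsilon> / 2" using T by (intro add_mono 1 2) auto
    finally show "norm (\<phi> (orb n T) + \<psi> (orb n T) - (L1 + L2)) \<le> \<epsilon>" by simp
  qed (use 1 2 in simp)
qed

lemma orb_uniform_limit_mult:
  assumes "orb_uniform_limit \<phi> T0"
  shows "orb_uniform_limit (\<lambda>T. C ** \<phi> T) T0"
  unfolding orb_uniform_limit_def
proof (intro allI impI)
  fix \<epsilon> :: real assume "\<epsilon> > 0"
  then have "\<epsilon> / (norm C + 1) > 0" by (simp add: add_nonneg_pos)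
  then obtain L n0 \<delta> where 1: "\<delta> > 0"
    "\<And>T n. invertible T \<Longrightarrow> dist T T0 < \<delta> \<Longrightarrow> n \<ge> n0 \<Longrightarrow> norm (\<phi> (orb n T) - L) \<le> \<epsilon> / (norm C + 1)"
    using orb_uniform_limitD[OF assms] by metis
  show "\<exists>L n0. \<exists>\<delta>>0. \<forall>T n. invertible T \<longrightarrow> dist T T0 < \<delta> \<longrightarrow> n0 \<le> n \<longrightarrow>
     norm (C ** \<phi> (orb n T) - L) \<le> \<epsilon>"
  proof (rule exI[of _ "C ** L"], rule exI[of _ n0], rule exI[of _ \<delta>], intro conjI allI impI)
    fix T n assume T: "invertible T" "dist T T0 < \<delta>" "n0 \<le> n"
    have "norm (C ** \<phi> (orb n T) - C ** L) \<le> norm C * norm (\<phi> (orb n T) - L)"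
      using norm_mat_mult_le[of C "\<phi> (orb n T) - L"] by (simp add: mm.diff_right)
    also have "\<dots> \<le> (norm C + 1) * (\<epsilon> / (norm C + 1))"
      using T by (intro mult_mono 1) auto
    also have "\<dots> = \<epsilon>" using norm_ge_zero[of C] by (simp add: add_nonneg_eq_0_iff)
    finally show "norm (C ** \<phi> (orb n T) - C ** L) \<le> \<epsilon>" .
  qed (rule 1)
qed

lemma orb_uniform_limit_sum:
  assumes "finite I" "\<And>i. i \<in> I \<Longrightarrow> orb_uniform_limit (\<phi> i) T0"
  shows "orb_uniform_limit (\<lambda>T. \<Sum>i\<in>I. \<phi> i T) T0"
  using assms
proof (induction I)
  case empty
  show ?case unfolding orb_uniform_limit_def
    by (intro allI impI exI[of _ 0] exI[of _ "1::real"]) simp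
qed (simp add: orb_uniform_limit_add)

text \<open>The centre is the value at iterate \<open>n0\<close> of \<open>T0\<close> itself: later
  iterates stay close to iterate \<open>n0\<close>, which depends continuously on the starting
  matrix.\<close>

lemma orb_uniform_limit_matpoly:
  fixes T0 :: "complex^'n^'n"
  assumes T0: "invertible T0"
    and p0: "\<And>R. normal_mat R \<Longrightarrow> same_traces R T0 \<Longrightarrow>
      matpoly p R ** matpoly p R = matpoly p R \<and> skew (matpoly p R) = 0"
  shows "orb_uniform_limit (matpoly p) T0"
  unfolding orb_uniform_limit_def
proof (intro allI impI)
  fix \<epsilon> :: real assume "\<epsilon> > 0"
  then have e2: "\<epsilon> / 2 > 0" by simp
  obtain n0 \<delta>1 where 1: "\<delta>1 > 0" "\<And>T n. invertible T \<Longrightarrow> dist T T0 < \<delta>1 \<Longrightarrow> n \<ge> n0 \<Longrightarrow>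
    norm (matpoly p (orb n T) - matpoly p (orb n0 T)) \<le> \<epsilon> / 2"
    using matpoly_orb_uniformly_Cauchy[OF T0 p0 e2] by metis
  have "continuous_on {T :: complex^'n^'n. invertible T} (\<lambda>T. matpoly p (orb n0 T))"
    by (intro continuous_on_matpoly continuous_on_orb)
  then obtain \<delta>2 where 2: "\<delta>2 > 0" "\<And>T. invertible T \<Longrightarrow> dist T T0 < \<delta>2 \<Longrightarrow>
    dist (matpoly p (orb n0 T)) (matpoly p (orb n0 T0)) < \<epsilon> / 2"
    using T0 e2 unfolding continuous_on_iff by (metis (no_types, lifting) mem_Collect_eq)
  show "\<exists>L n0. \<exists>\<delta>>0. \<forall>T n. invertible T \<longrightarrow> dist T T0 < \<delta> \<longrightarrow> n0 \<le> n \<longrightarrow>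
     norm (matpoly p (orb n T) - L) \<le> \<epsilon>"
  proof (rule exI[of _ "matpoly p (orb n0 T0)"], rule exI[of _ n0], rule exI[of _ "min \<delta>1 \<delta>2"],
      intro conjI allI impI)
    fix T n assume T: "invertible T" "dist T T0 < min \<delta>1 \<delta>2" "n0 \<le> n"
    have "norm (matpoly p (orb n T) - matpoly p (orb n0 T)) \<le> \<epsilon> / 2" using 1 T by simp
    moreover have "norm (matpoly p (orb n0 T) - matpoly p (orb n0 T0)) < \<epsilon> / 2"
      using 2(2)[of T] T by (simp add: dist_norm)
    ultimately show "norm (matpoly p (orb n T) - matpoly p (orb n0 T0)) \<le> \<epsilon>"
      using norm_triangle_ineq[of "matpoly p (orb n T) - matpoly p (orb n0 T)"
          "matpoly p (orb n0 T) - matpoly p (orb n0 T0)"] by simp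
  qed (use 1 2 in simp)
qed

text \<open>On normal matrices with the traces of \<open>T0\<close> the Lagrange polynomials
  \<open>p l\<close> give the spectral projections, so the result for projections applies to each of
  them, and their combination \<open>h\<close> weighted by eigenvalues recovers the matrix.\<close>

lemma orb_uniform_limit_ident:
  fixes T0 :: "complex^'n^'n"
  assumes T0: "invertible T0"
  shows "orb_uniform_limit (\<lambda>T. T) T0"
proof -
  obtain \<Lambda> where \<Lambda>: "finite \<Lambda>" "\<And>R. normal_mat R \<Longrightarrow> same_traces R T0 \<Longrightarrow>
    \<exists>V d. unitary_mat V \<and> R = V ** diag_mat d ** V\<^sup>H \<and> range d \<subseteq> \<Lambda>"
    using normal_common_spectrum[of T0] by metis
  have "\<exists>p. \<forall>z\<in>\<Lambda>. poly p z = (if z = l then 1 else 0)" for l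
    by (rule poly_interpolation[OF \<Lambda>(1)])
  then obtain p where p: "\<And>l z. z \<in> \<Lambda> \<Longrightarrow> poly (p l) z = (if z = l then 1 else 0)" by metis
  have tame: "orb_uniform_limit (matpoly (p l)) T0" for l
  proof (rule orb_uniform_limit_matpoly[OF T0])
    fix R assume "normal_mat R" "same_traces R T0"
    then obtain V d where V: "unitary_mat V" "R = V ** diag_mat d ** V\<^sup>H" "range d \<subseteq> \<Lambda>"
      using \<Lambda> by blast
    define q where "q i = poly (p l) (d i)" for i
    have "d i \<in> \<Lambda>" for i using V(3) by auto
    then have "q i = (if d i = l then 1 else 0)" for i by (simp add: p q_def)
    then have q: "q i * q i = q i" "cnj (q i) = q i" for i by simp_all
    have R: "matpoly (p l) R = V ** diag_mat q ** V\<^sup>H"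
      by (simp add: V(2) matpoly_unitary_diag[OF V(1)] q_def[abs_def])
    show "matpoly (p l) R ** matpoly (p l) R = matpoly (p l) R \<and> skew (matpoly (p l) R) = 0"
      unfolding R unitary_conj_mult[OF V(1)] diag_mat_mult
      by (simp add: q skew_def adjoint_mult adjoint_diag_mat matrix_mul_assoc)
  qed
  define h where "h T = (\<Sum>l\<in>\<Lambda>. mat l ** matpoly (p l) T)" for T :: "complex^'n^'n"
  have h: "orb_uniform_limit h T0"
    unfolding h_def by (intro orb_uniform_limit_sum orb_uniform_limit_mult tame \<Lambda>)
  have hR: "h R = R" if R: "normal_mat R" "same_traces R T0" for R
  proof -
    obtain V d where V: "unitary_mat V" "R = V ** diag_mat d ** V\<^sup>H" "range d \<subseteq> \<Lambda>"
      using \<Lambda> R by blast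
    have d\<Lambda>: "d i \<in> \<Lambda>" for i using V(3) by auto
    define q where "q = (\<Sum>l\<in>\<Lambda>. smult l (p l))"
    have "poly q (d i) = (\<Sum>l\<in>\<Lambda>. l * (if d i = l then 1 else 0))" for i
      unfolding q_def poly_sum by (intro sum.cong) (simp_all add: p d\<Lambda>)
    also have "\<dots> i = d i" for i
      using \<Lambda>(1) by (simp add: if_distrib[of "\<lambda>x. _ * x"] d\<Lambda> cong: if_cong)
    finally have "poly q (d i) = d i" for i .
    moreover have "h R = matpoly q R" by (simp add: h_def q_def matpoly_sum matpoly_smult)
    ultimately show ?thesis by (simp add: V(2) matpoly_unitary_diag[OF V(1)])
  qed
  show ?thesis
    unfolding orb_uniform_limit_def
  proof (intro allI impI)
    fix \<epsilon> :: real assume "\<epsilon> > 0"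
    then have e2: "\<epsilon> / 2 > 0" by simp
    obtain L n1 \<delta>1 where 1: "\<delta>1 > 0"
      "\<And>T n. invertible T \<Longrightarrow> dist T T0 < \<delta>1 \<Longrightarrow> n \<ge> n1 \<Longrightarrow> norm (h (orb n T) - L) \<le> \<epsilon> / 2"
      using orb_uniform_limitD[OF h e2] by metis
    \<comment> \<open>Since \<open>h\<close> fixes the normal matrices concerned,
      \<open>h (orb n T)\<close> is eventually close to \<open>orb n T\<close>, uniformly near
      \<open>T0\<close>.\<close>
    have conth: "continuous_on UNIV (\<lambda>T. norm (h T - T))"
      unfolding h_def by (intro continuous_intros mm.continuous_on)
    obtain n2 \<delta>2 where 2: "\<delta>2 > 0"
      "\<And>T n. invertible T \<Longrightarrow> dist T T0 < \<delta>2 \<Longrightarrow> n \<ge> n2 \<Longrightarrow> norm (h (orb n T) - orb n T) < \<epsilon> / 2"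
      using orb_uniformly_normal[OF T0 conth _ e2] hR
      by (metis (mono_tags, lifting) norm_zero right_minus_eq)
    show "\<exists>L n0. \<exists>\<delta>>0. \<forall>T n. invertible T \<longrightarrow> dist T T0 < \<delta> \<longrightarrow> n0 \<le> n \<longrightarrow> norm (orb n T - L) \<le> \<epsilon>"
    proof (rule exI[of _ L], rule exI[of _ "max n1 n2"], rule exI[of _ "min \<delta>1 \<delta>2"],
        intro conjI allI impI)
      fix T n assume T: "invertible T" "dist T T0 < min \<delta>1 \<delta>2" "max n1 n2 \<le> n"
      have "norm (h (orb n T) - L) \<le> \<epsilon> / 2" "norm (h (orb n T) - orb n T) < \<epsilon> / 2"
        using 1 2 T by simp_all
      then show "norm (orb n T - L) \<le> \<epsilon>"
        using norm_triangle_ineq4[of "h (orb n T) - L" "h (orb n T) - orb n T"] by simp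
    qed (use 1 2 in simp)
  qed
qed

text \<open>The uniform condition with the starting matrix held at \<open>T\<close> is the Cauchy
  property, so \<open>lim\<close> in \<open>aluthge_inf\<close> is an actual limit.\<close>

lemma orb_convergent:
  fixes T :: "complex^'n^'n"
  assumes "invertible T"
  shows "(\<lambda>n. orb n T) \<longlonglongrightarrow> aluthge_inf T"
proof -
  have "Cauchy (\<lambda>n. orb n T)"
  proof (rule metric_CauchyI)
    fix e :: real assume "e > 0"
    then have "e / 3 > 0" by simp
    obtain L n0 \<delta> where L: "\<delta> > 0"
      "\<And>T' n. invertible T' \<Longrightarrow> dist T' T < \<delta> \<Longrightarrow> n \<ge> n0 \<Longrightarrow> norm (orb n T' - L) \<le> e / 3"
      using orb_uniform_limitD[OF orb_uniform_limit_ident[OF assms] \<open>e / 3 > 0\<close>] by metis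
    have "dist (orb m T) (orb n T) < e" if "m \<ge> n0" "n \<ge> n0" for m n
    proof -
      have "dist (orb m T) (orb n T) \<le> dist (orb m T) L + dist (orb n T) L" by (rule dist_triangle2)
      also have "\<dots> \<le> e / 3 + e / 3" using L assms that by (intro add_mono) (simp_all add: dist_norm)
      finally show ?thesis using \<open>e > 0\<close> by linarith
    qed
    then show "\<exists>M. \<forall>m\<ge>M. \<forall>n\<ge>M. dist (orb m T) (orb n T) < e" by blast
  qed
  then show ?thesis
    unfolding aluthge_inf_def by (simp add: Cauchy_convergent convergent_LIMSEQ_iff[symmetric])
qed

theorem theorem5p5:
  shows "continuous_on {T :: complex^'r^'r. invertible T} aluthge_inf"
  unfolding continuous_on_iff
proof (intro ballI allI impI)
  fix T0 :: "complex^'r^'r" and e :: real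
  assume "T0 \<in> {T. invertible T}" and e: "e > 0"
  then have T0: "invertible T0" and e3: "e / 3 > 0" by simp_all
  obtain L n0 \<delta> where L: "\<delta> > 0"
    "\<And>T n. invertible T \<Longrightarrow> dist T T0 < \<delta> \<Longrightarrow> n \<ge> n0 \<Longrightarrow> norm (orb n T - L) \<le> e / 3"
    using orb_uniform_limitD[OF orb_uniform_limit_ident[OF T0] e3] by metis
  \<comment> \<open>The closed bound passes to the limit in \<open>n\<close>; two limits near
    \<open>L\<close> then differ by at most two thirds of \<open>e\<close>.\<close>
  have lim: "dist (aluthge_inf T) L \<le> e / 3" if "invertible T" "dist T T0 < \<delta>" for T
  proof (rule LIMSEQ_le_const2)
    show "(\<lambda>n. dist (orb n T) L) \<longlonglongrightarrow> dist (aluthge_inf T) L"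
      by (intro tendsto_intros orb_convergent that)
    show "\<exists>N. \<forall>n\<ge>N. dist (orb n T) L \<le> e / 3"
      using L(2)[OF that] by (auto simp: dist_norm)
  qed
  have "dist (aluthge_inf T) (aluthge_inf T0) < e" if "invertible T" "dist T T0 < \<delta>" for T
    using dist_triangle2[of "aluthge_inf T" "aluthge_inf T0" L] lim[OF that] lim[OF T0] L(1) e by simp
  then show "\<exists>d>0. \<forall>x'\<in>{T. invertible T}. dist x' T0 < d \<longrightarrow> dist (aluthge_inf x') (aluthge_inf T0) < e"
    using L(1) by blast
qed

end
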